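(* Consider the symmetric simple exclusion process on $\mathbb Z$ with initial configuration $\eta_0(x)=\mathbf 1\{x\text{ even}\}$, $x\in\mathbb Z$, and let $J_t$ be the integrated flux of particles through the point $-1/2$ up to time $t$. Then $$\sup_{t\ge 0}\mathbb E\bigl(e^{|J_t/t^{1/4}|}\bigr)<\infty .$$ Furthermore, for all $K>0$ and all $t$ large enough $$\mathbb P\bigl(|J_t|>K t^{1/4}\log t\bigr)\le c\,t^{-K},$$ where $c$ is a constant.
   Context: The symmetric simple exclusion process is the Markov process on $\{0,1\}^{\mathbb Z}$ with generator $\mathcal L^{ex}f(\eta)=\frac12\sum_{x\in\mathbb Z}[f(\eta^{x,x+1})-f(\eta)]$, where $\eta^{x,x+1}$ is obtained from $\eta$ by exchanging the values at $x$ and $x+1$. It is constructed as follows. Let $(N_t(x))_{t\ge0}$, $x\in\mathbb Z$, be independent Poisson processes of rate $\frac12$, with $N_t(x)$ attached to the bond $\{x,x+1\}$. For each $x\in\mathbb Z$ the stirring particle $X^x_t$ starts at $X^x_0=x$ and, at each event of a Poisson process attached to a bond having the current position of the particle as an endpoint, it jumps to the other endpoint of that bond. Almost surely, for each $t$ the map $x\mapsto X^x_t$ is a bijection of $\mathbb Z$, and $\eta_t$ is defined by $\eta_t(X^x_t)=\eta_0(x)$. The integrated flux through $-1/2$ is $$J_t=\sum_{x<0}\eta_0(x)\mathbf 1\{X^x_t\ge 0\}-\sum_{x\ge 0}\eta_0(x)\mathbf 1\{X^x_t<0\}.$$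
   Formalization: The supremum over t ≥ 0 is replaced by the supremum over t ≥ t_0 for every t_0 > 0: at t = 0 the quotient is 0/0, and as t → 0+ the expectation is at least of order t·exp(t^{-1/4}), which tends to infinity. *)

theory Defs
  imports "HOL-Probability.Probability"
begin

definition poisson_process :: "'w measure \<Rightarrow> real \<Rightarrow> (real \<Rightarrow> 'w \<Rightarrow> nat) \<Rightarrow> bool" where
  "poisson_process M r N \<longleftrightarrow>
     (\<forall>t\<ge>0. N t \<in> measurable M (count_space UNIV)) \<and>
     (\<forall>\<omega>\<in>space M. N 0 \<omega> = 0 \<and> mono_on {0..} (\<lambda>t. N t \<omega>) \<and>
        (\<forall>t\<ge>0. continuous (at_right t) (\<lambda>u. N u \<omega>))) \<and>
     (\<forall>s t. 0 \<le> s \<longrightarrow> s < t \<longrightarrow>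
        distr M (count_space UNIV) (\<lambda>\<omega>. N t \<omega> - N s \<omega>) = measure_pmf (poisson_pmf (r * (t - s)))) \<and>
     (\<forall>\<tau>. 0 \<le> \<tau> 0 \<longrightarrow> strict_mono \<tau> \<longrightarrow>
        prob_space.indep_vars M (\<lambda>_. count_space UNIV)
          (\<lambda>i \<omega>. N (\<tau> (Suc i)) \<omega> - N (\<tau> i) \<omega>) (UNIV :: nat set))"

text \<open>Each process is regarded as one random element, its whole path on \<open>[0, \<infinity>)\<close>, with values in a
  product space; independence is that of the family of these path-valued variables.\<close>

definition independent_poisson_processes ::
    "'w measure \<Rightarrow> real \<Rightarrow> ('i \<Rightarrow> real \<Rightarrow> 'w \<Rightarrow> nat) \<Rightarrow> bool" where
  "independent_poisson_processes M r N \<longleftrightarrow>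
     (\<forall>x. poisson_process M r (N x)) \<and>
     prob_space.indep_vars M (\<lambda>_. PiM {0..} (\<lambda>_. count_space UNIV))
       (\<lambda>x \<omega>. \<lambda>t\<in>{0..}. N x t \<omega>) UNIV"

text \<open>Below, \<open>n x\<close> is a realisation of the process attached to the bond \<open>{x, x + 1}\<close>.
  A nondecreasing right-continuous counting path has an event at time \<open>u\<close> iff it jumps there.\<close>

definition event_at :: "(real \<Rightarrow> nat) \<Rightarrow> real \<Rightarrow> bool" where
  "event_at p u \<longleftrightarrow> 0 < u \<and> (\<forall>s\<in>{0..<u}. p s < p u)"

text \<open>\<open>stirring_step n x k\<close> is the time of the \<open>k\<close>-th jump of the stirring particle started at \<open>x\<close>
  together with its position just after that jump. The infimum is the first event after time \<open>s\<close> on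
  one of the two bonds \<open>{y, y + 1}\<close> and \<open>{y - 1, y}\<close>. Almost surely such an event exists,
  events on different bonds are never simultaneous, and the jump times tend to infinity, so the
  values of these functions in the exceptional cases are irrelevant.\<close>

primrec stirring_step :: "(int \<Rightarrow> real \<Rightarrow> nat) \<Rightarrow> int \<Rightarrow> nat \<Rightarrow> real \<times> int" where
  "stirring_step n x 0 = (0, x)"
| "stirring_step n x (Suc k) =
     (let (s, y) = stirring_step n x k;
          u = Inf {u. s < u \<and> (event_at (n y) u \<or> event_at (n (y - 1)) u)}
      in (u, if event_at (n y) u then y + 1 else y - 1))"

definition stirring :: "(int \<Rightarrow> real \<Rightarrow> nat) \<Rightarrow> int \<Rightarrow> real \<Rightarrow> int" where
  "stirring n x t = snd (stirring_step n x (LEAST k. t < fst (stirring_step n x (Suc k))))"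

text \<open>Integrated flux through \<open>-1/2\<close> up to time \<open>t\<close> of the exclusion process
  \<open>\<eta>\<^sub>t (stirring n x t) = \<eta>\<^sub>0 x\<close> started from \<open>\<eta>\<^sub>0\<close>.
  Almost surely only finitely many terms of either sum are nonzero.\<close>

definition flux :: "(int \<Rightarrow> real) \<Rightarrow> (int \<Rightarrow> real \<Rightarrow> nat) \<Rightarrow> real \<Rightarrow> real" where
  "flux \<eta>\<^sub>0 n t =
     (\<Sum>\<^sub>\<infinity>x\<in>{..<0}. \<eta>\<^sub>0 x * of_bool (stirring n x t \<ge> 0)) -
     (\<Sum>\<^sub>\<infinity>x\<in>{0..}. \<eta>\<^sub>0 x * of_bool (stirring n x t < 0))"

text \<open>The flux of the exclusion process started from the indicator of the even integers, as a random
  variable.\<close>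

definition alternating_flux :: "(int \<Rightarrow> real \<Rightarrow> 'w \<Rightarrow> nat) \<Rightarrow> real \<Rightarrow> 'w \<Rightarrow> real" where
  "alternating_flux N t \<omega> = flux (\<lambda>x. of_bool (even x)) (\<lambda>x s. N x s \<omega>) t"

end

(*
Replace the clocks on [0, t] by m sweeps of independent lazy swaps, each performed with the
probability p that its clock rings within time t / m. For such a sequence of lazy swaps and g >= 0,
E prod_{x in A} g(X^x) <= prod_{x in A} E g(X^x): conditioning on the first swap, the induction step
is the inequality g(a) g(b) <= ((1-p) g(a) + p g(b)) ((1-p) g(b) + p g(a)), whose defect is
p (1-p) (g(a) - g(b))^2. Applied to g = exp(l 1{. >= 0}) it gives
E exp(l J) <= exp((e^l - 1) S + (e^-l - 1) S'), where S and S' are the means of the two sums that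
make up J. A second moment bound gives S = O(sqrt t), reflection symmetry and monotonicity give
|S - S'| <= 1, and l = +-t^(-1/4) makes the exponent bounded.

Almost surely there are bonds on both sides of the origin, arbitrarily far out, without an event up to
time t. They confine the particles, and on a finite box the discrete dynamics has the true flux as
soon as no sweep contains two events. Fatou's lemma transfers the bound, and the tail estimate is
Markov's inequality.
*)
theory Submission
  imports Defs
begin

text \<open>A bound of order t^(1/4) needs a cancellation: each of the two crossing sums has mean of
  order sqrt t, so the means must agree up to a constant before l may be as large as t^(-1/4). The
  exponent splits as (e^l + e^-l - 2) S + (e^-l - 1) (S' - S), where the large S meets only a
  coefficient of order l^2. The balance of S and S' rests on reflection symmetry and monotonicity,
  so the discretisation has to respect both exactly: the bond order in a sweep is symmetric and the
  flip probability is at most 1/2. Finite lists of coins keep the negative dependence a finite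
  induction, with no semigroup of an infinite system. The discrete bound sees box and mesh only
  through v, an upper bound for the mean square displacement, which stays below t + 1 when the mesh
  is chosen after the box. Box and mesh then run along one sequence, and almost sure eventual
  equality with the true flux takes the place of convergence in law.\<close>

section \<open>Lazy swaps and negative dependence\<close>

definition bond_swap :: "int \<Rightarrow> int \<Rightarrow> int" where
  "bond_swap b = Transposition.transpose b (b + 1)"

lemma bond_swap_eq: "bond_swap b x = (if x = b then b + 1 else if x = b + 1 then b else x)"
  by (simp add: bond_swap_def Transposition.transpose_def)

lemma inj_on_bond_swap: "inj_on (bond_swap b) A"
  unfolding bond_swap_def by (meson inj_on_subset inj_transpose subset_UNIV)

text \<open>Bond and coin are separate components, so that for a fixed deterministic bond list only
  the coins are random. The head of the list acts first.\<close>

definition stir :: "(int \<times> bool) list \<Rightarrow> int \<Rightarrow> int" where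
  "stir ops = fold (\<lambda>(b, c) x. if c then bond_swap b x else x) ops"

lemma stir_Nil [simp]: "stir [] x = x"
  and stir_Cons [simp]: "stir ((b, c) # ops) x = stir ops (if c then bond_swap b x else x)"
  and stir_append: "stir (ops @ ops') x = stir ops' (stir ops x)"
  by (simp_all add: stir_def)

text \<open>The expectation over \<open>l\<close> independent coins of success probability
  \<open>p\<close>, written as a recursion so that conditioning on the first coin is a mere
  unfolding. \<open>coin_mean_eq_sum\<close> and \<open>coin_mean_eq_expectation\<close> link it to
  a probability space.\<close>

primrec coin_mean :: "real \<Rightarrow> nat \<Rightarrow> (bool list \<Rightarrow> real) \<Rightarrow> real" where
  "coin_mean p 0 F = F []"
| "coin_mean p (Suc l) F =
     (1 - p) * coin_mean p l (\<lambda>cs. F (False # cs)) + p * coin_mean p l (\<lambda>cs. F (True # cs))"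

text \<open>\<open>walk_op p bs f x\<close> is the mean of \<open>f\<close> at the final position of one particle started at \<open>x\<close>; the
  swap across the head of \<open>bs\<close> is performed first.\<close>

primrec walk_op :: "real \<Rightarrow> int list \<Rightarrow> (int \<Rightarrow> real) \<Rightarrow> int \<Rightarrow> real" where
  "walk_op p [] f = f"
| "walk_op p (b # bs) f =
     (\<lambda>x. (1 - p) * walk_op p bs f x + p * walk_op p bs f (bond_swap b x))"

lemma coin_mean_cmult: "coin_mean p l (\<lambda>cs. a * F cs) = a * coin_mean p l F"
  by (induction l arbitrary: F) (simp_all add: algebra_simps)

lemma walk_op_mono:
  assumes "0 \<le> p" "p \<le> 1" and "\<And>x. f x \<le> g x"
  shows "walk_op p bs f x \<le> walk_op p bs g x"
  using assms by (induction bs arbitrary: x) (auto intro!: add_mono mult_left_mono)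

lemma walk_op_affine:
  "walk_op p bs (\<lambda>x. u + v * f x) x = u + v * walk_op p bs f x"
  by (induction bs arbitrary: x) (auto simp: algebra_simps)

lemma walk_op_const: "walk_op p bs (\<lambda>x. u) x = u"
  using walk_op_affine[of p bs u 0 "\<lambda>_. 0"] by simp

lemma walk_op_append: "walk_op p (bs @ bs') f = walk_op p bs (walk_op p bs' f)"
  by (induction bs) simp_all

text \<open>Sites off the bond are fixed and give a common nonnegative factor. With at most one
  endpoint in \<open>A\<close> the two sides agree by linearity; only a full pair gives a genuine
  inequality, because the swap leaves the pair invariant as a set.\<close>

lemma prod_bond_swap_le:
  fixes g :: "int \<Rightarrow> real"
  assumes "finite A" "\<And>x. 0 \<le> g x" "0 \<le> p" "p \<le> 1"
  shows "(1 - p) * (\<Prod>x\<in>A. g x) + p * (\<Prod>x\<in>A. g (bond_swap b x))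
    \<le> (\<Prod>x\<in>A. (1 - p) * g x + p * g (bond_swap b x))"
proof -
  have fix_pt: "bond_swap b x = x" if "x \<noteq> b" "x \<noteq> b + 1" for x
    using that by (simp add: bond_swap_eq)
  define B where "B = A \<inter> {b, b + 1}"
  define r where "r = (\<Prod>x\<in>A - B. g x)"
  have fin: "finite B" "B \<subseteq> A" using assms by (auto simp: B_def)
  have split: "(\<Prod>x\<in>A. h x) = (\<Prod>x\<in>A - B. h x) * (\<Prod>x\<in>B. h x)" for h :: "int \<Rightarrow> real"
    using prod.subset_diff[OF fin(2) assms(1)] by simp
  have out: "bond_swap b x = x" if "x \<in> A - B" for x
    using that by (intro fix_pt) (auto simp: B_def)
  have r1: "(\<Prod>x\<in>A - B. g (bond_swap b x)) = r"
    unfolding r_def by (intro prod.cong) (auto simp: out)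
  have r2: "(\<Prod>x\<in>A - B. (1 - p) * g x + p * g (bond_swap b x)) = r"
    unfolding r_def by (intro prod.cong refl) (simp add: out algebra_simps)
  have r0: "0 \<le> r" unfolding r_def using assms(2) by (intro prod_nonneg) auto
  have key: "(1 - p) * (\<Prod>x\<in>B. g x) + p * (\<Prod>x\<in>B. g (bond_swap b x))
    \<le> (\<Prod>x\<in>B. (1 - p) * g x + p * g (bond_swap b x))"
  proof -
    consider "B = {}" | "B = {b}" | "B = {b + 1}" | "B = {b, b + 1}"
      unfolding B_def by blast
    then show ?thesis
    proof cases
      case 4
      have sw: "bond_swap b b = b + 1" "bond_swap b (b + 1) = b" by (simp_all add: bond_swap_eq)
      have "((1 - p) * g b + p * g (b + 1)) * ((1 - p) * g (b + 1) + p * g b)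
          - g b * g (b + 1) = p * (1 - p) * (g b - g (b + 1))\<^sup>2"
        by (simp add: algebra_simps power2_eq_square)
      moreover have "\<dots> \<ge> 0" using assms by simp
      ultimately show ?thesis using 4 sw by (simp add: algebra_simps)
    qed (simp_all add: bond_swap_eq)
  qed
  have "(1 - p) * (r * (\<Prod>x\<in>B. g x)) + p * (r * (\<Prod>x\<in>B. g (bond_swap b x)))
      = r * ((1 - p) * (\<Prod>x\<in>B. g x) + p * (\<Prod>x\<in>B. g (bond_swap b x)))"
    by (simp add: algebra_simps)
  also have "\<dots> \<le> r * (\<Prod>x\<in>B. (1 - p) * g x + p * g (bond_swap b x))"
    using key r0 by (rule mult_left_mono)
  finally show ?thesis
    unfolding split r1 r2 r_def[symmetric] .
qed

lemma walk_op_nonneg: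
  assumes "0 \<le> p" "p \<le> 1" and "\<And>x. 0 \<le> f x"
  shows "0 \<le> walk_op p bs f x"
  using walk_op_mono[of p "\<lambda>_. 0" f bs x] assms by (simp add: walk_op_const)

text \<open>Once the first coin is known, the particles continue from \<open>A\<close> or from its
  image under the swap, hence the induction over all finite \<open>A\<close>. The swap inequality is
  applied to \<open>walk_op p bs g\<close>, the one-particle mean over the remaining bonds.\<close>

lemma liggett_inequality:
  fixes g :: "int \<Rightarrow> real"
  assumes "finite A" "\<And>x. 0 \<le> g x" "0 \<le> p" "p \<le> 1"
  shows "coin_mean p (length bs) (\<lambda>cs. \<Prod>x\<in>A. g (stir (zip bs cs) x))
    \<le> (\<Prod>x\<in>A. walk_op p bs g x)"
  using assms(1)
proof (induction bs arbitrary: A)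
  case (Cons b bs)
  have inj: "inj_on (bond_swap b) A" by (rule inj_on_bond_swap)
  have "coin_mean p (length bs) (\<lambda>cs. \<Prod>x\<in>A. g (stir (zip bs cs) (bond_swap b x)))
      = coin_mean p (length bs) (\<lambda>cs. \<Prod>x\<in>bond_swap b ` A. g (stir (zip bs cs) x))"
    using inj by (simp add: prod.reindex)
  also have "\<dots> \<le> (\<Prod>x\<in>bond_swap b ` A. walk_op p bs g x)"
    using Cons by simp
  also have "\<dots> = (\<Prod>x\<in>A. walk_op p bs g (bond_swap b x))"
    using inj by (simp add: prod.reindex)
  finally have 1: "coin_mean p (length bs) (\<lambda>cs. \<Prod>x\<in>A. g (stir (zip bs cs) (bond_swap b x)))
    \<le> (\<Prod>x\<in>A. walk_op p bs g (bond_swap b x))" .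
  have "coin_mean p (length (b # bs)) (\<lambda>cs. \<Prod>x\<in>A. g (stir (zip (b # bs) cs) x))
    \<le> (1 - p) * (\<Prod>x\<in>A. walk_op p bs g x) + p * (\<Prod>x\<in>A. walk_op p bs g (bond_swap b x))"
    using 1 Cons assms by (auto intro!: add_mono mult_left_mono)
  also have "\<dots> \<le> (\<Prod>x\<in>A. walk_op p (b # bs) g x)"
    using prod_bond_swap_le[of A "walk_op p bs g" p b] Cons assms
    by (simp add: walk_op_nonneg)
  finally show ?case .
qed simp

section \<open>Monotonicity and reflection symmetry of the one-particle walk\<close>

lemma mono_int_iff: "mono (f :: int \<Rightarrow> real) \<longleftrightarrow> (\<forall>x. f x \<le> f (x + 1))"
proof
  assume *: "\<forall>x. f x \<le> f (x + 1)"
  show "mono f"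
  proof (rule monoI)
    fix x y :: int assume "x \<le> y"
    then show "f x \<le> f y"
      by (induction y rule: int_ge_induct) (use * order_trans in auto)
  qed
qed (simp add: monoD)

text \<open>Across the bond itself a lazy swap multiplies the increment by 1 - 2p, which has to be
  nonnegative; every other pair of neighbours keeps its order under the swap.\<close>

lemma mono_walk_op:
  assumes "0 \<le> p" "p \<le> 1 / 2" "mono f"
  shows "mono (walk_op p bs f)"
proof (induction bs)
  case (Cons b bs)
  define h where "h = walk_op p bs f"
  have h: "h x \<le> h y" if "x \<le> y" for x y using Cons that by (simp add: monoD h_def)
  have "(1 - p) * h x + p * h (bond_swap b x) \<le> (1 - p) * h (x + 1) + p * h (bond_swap b (x + 1))" for x
  proof (cases "x = b")
    case True
    have "(1 - 2 * p) * h b \<le> (1 - 2 * p) * h (b + 1)"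
      using assms h by (intro mult_left_mono) auto
    then show ?thesis using True by (simp add: bond_swap_eq algebra_simps)
  next
    case False
    then have "bond_swap b x \<le> bond_swap b (x + 1)"
      by (auto simp: bond_swap_eq)
    then show ?thesis
      using assms h by (intro add_mono mult_left_mono) auto
  qed
  then show ?case by (simp add: mono_int_iff h_def)
qed (use assms in simp)

text \<open>The bonds of the box are listed from the centre outwards in commuting pairs that the reflection
  \<open>x \<mapsto> -1 - x\<close> exchanges, so that even the discrete-time walk is exactly reflection symmetric.\<close>

fun bonds :: "nat \<Rightarrow> int list" where
  "bonds 0 = [-1]"
| "bonds (Suc k) = int k # (- 2 - int k) # bonds k"

lemma set_bonds: "set (bonds k) = {-1 - int k..int k - 1}"
  by (induction k) auto

lemma distinct_bonds: "distinct (bonds k)"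
  by (induction k) (auto simp: set_bonds)

lemma bond_swap_reflect: "bond_swap b (-1 - x) = -1 - bond_swap (- 2 - b) x"
  by (auto simp: bond_swap_eq)

lemma walk_op_bonds_reflect:
  "walk_op p (bonds k) (\<lambda>x. f (-1 - x)) x = walk_op p (bonds k) f (-1 - x)"
proof (induction k arbitrary: x)
  case (Suc k)
  \<comment> \<open>Reflection exchanges the two new bonds and so reverses the order of their swaps;
    disjoint bonds make the order immaterial.\<close>
  have [simp]: "bond_swap (- 2 - int k) (bond_swap (int k) x) = bond_swap (int k) (bond_swap (- 2 - int k) x)"
    by (auto simp: bond_swap_eq)
  show ?case
    using Suc by (simp add: bond_swap_reflect algebra_simps)
qed (simp add: bond_swap_reflect)

definition sweeps :: "nat \<Rightarrow> nat \<Rightarrow> int list" where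
  "sweeps k m = concat (replicate m (bonds k))"

lemma sweeps_0 [simp]: "sweeps k 0 = []"
  and sweeps_Suc [simp]: "sweeps k (Suc m) = bonds k @ sweeps k m"
  by (simp_all add: sweeps_def)

lemma walk_op_sweeps_reflect:
  "walk_op p (sweeps k m) (\<lambda>x. f (-1 - x)) x = walk_op p (sweeps k m) f (-1 - x)"
proof (induction m arbitrary: x)
  case (Suc m)
  have "walk_op p (sweeps k (Suc m)) (\<lambda>x. f (-1 - x)) x
     = walk_op p (bonds k) (\<lambda>x. walk_op p (sweeps k m) f (-1 - x)) x"
    unfolding sweeps_Suc walk_op_append using Suc by presburger
  then show ?case by (simp add: walk_op_append walk_op_bonds_reflect)
qed simp

section \<open>Second moment\<close>

text \<open>First-order expansion in \<open>p\<close>. The linear term is the generator up to its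
  rate; the quadratic error depends on \<open>f\<close> only through its increments, which matters
  because \<open>f\<close> will be an unbounded squared distance.\<close>

lemma walk_op_taylor:
  assumes "0 \<le> p" "p \<le> 1" and B: "\<And>b x. b \<in> set bs \<Longrightarrow> \<bar>f (bond_swap b x) - f x\<bar> \<le> B"
  shows "walk_op p bs f x \<le> f x + p * (\<Sum>b\<leftarrow>bs. f (bond_swap b x) - f x) + p\<^sup>2 * (2 * B * (real (length bs))\<^sup>2)"
  using B
proof (induction bs arbitrary: x)
  case (Cons b bs)
  define S where "S x = (\<Sum>b\<leftarrow>bs. f (bond_swap b x) - f x)" for x
  define l where "l = real (length bs)"
  have B0: "0 \<le> B" using order_trans[OF abs_ge_zero Cons.prems[of b x]] by simp
  have S: "\<bar>S x\<bar> \<le> l * B" for x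
  proof -
    have "\<bar>S x\<bar> \<le> (\<Sum>b\<leftarrow>bs. \<bar>f (bond_swap b x) - f x\<bar>)"
      unfolding S_def using sum_list_abs[of "map (\<lambda>b. f (bond_swap b x) - f x) bs"] by (simp add: o_def)
    also have "\<dots> \<le> (\<Sum>b\<leftarrow>bs. B)" by (intro sum_list_mono Cons.prems) auto
    finally show ?thesis by (simp add: l_def sum_list_triv)
  qed
  have IH: "walk_op p bs f x \<le> f x + p * S x + p\<^sup>2 * (2 * B * l\<^sup>2)" for x
    unfolding S_def l_def by (rule Cons.IH) (use Cons.prems in auto)
  have "walk_op p (b # bs) f x
    \<le> (1 - p) * (f x + p * S x + p\<^sup>2 * (2 * B * l\<^sup>2))
      + p * (f (bond_swap b x) + p * S (bond_swap b x) + p\<^sup>2 * (2 * B * l\<^sup>2))"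
    using IH assms by (auto intro!: add_mono mult_left_mono)
  \<comment> \<open>The first swap moves the point at which \<open>S\<close> is evaluated. This
    costs \<open>p\<close> squared times at most 2Bl, and 2Bl + 2Bl^2 <= 2B(l + 1)^2 closes the
    induction.\<close>
  also have "\<dots> = f x + p * (f (bond_swap b x) - f x + S x) + p\<^sup>2 * (S (bond_swap b x) - S x)
      + p\<^sup>2 * (2 * B * l\<^sup>2)"
    by (simp add: algebra_simps power2_eq_square)
  also have "\<dots> \<le> f x + p * (f (bond_swap b x) - f x + S x) + p\<^sup>2 * (2 * B * l)
      + p\<^sup>2 * (2 * B * l\<^sup>2)"
    using S[of x] S[of "bond_swap b x"]
    by (intro add_mono mult_left_mono order_refl) (auto simp: abs_le_iff algebra_simps)
  also have "\<dots> \<le> f x + p * (f (bond_swap b x) - f x + S x) + p\<^sup>2 * (2 * B * (l + 1)\<^sup>2)"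
  proof -
    have "p\<^sup>2 * (2 * B * (l + 1)\<^sup>2) = p\<^sup>2 * (2 * B * l) + p\<^sup>2 * (2 * B * l\<^sup>2) + p\<^sup>2 * (2 * B * (l + 1))"
      by (simp add: algebra_simps power2_eq_square)
    moreover have "0 \<le> p\<^sup>2 * (2 * B * (l + 1))" using B0 by (simp add: l_def)
    ultimately show ?thesis by simp
  qed
  finally show ?case by (simp add: S_def l_def add.commute)
qed simp

lemma sum_list_bonds: "(\<Sum>b\<leftarrow>bonds k. F b) = sum F {-1 - int k..int k - 1}" for F :: "int \<Rightarrow> real"
  by (metis distinct_bonds set_bonds sum_list_distinct_conv_sum_set)

definition sq_dist :: "int \<Rightarrow> int \<Rightarrow> real" where "sq_dist y x = (real_of_int (x - y))\<^sup>2"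

text \<open>Only the two bonds touching \<open>x\<close> contribute, 1 + 2d and 1 - 2d, so the drift
  cancels. At an edge of the box one of them is missing; since \<open>y\<close> lies in the box, d
  has the sign that makes the remaining contribution at most 1.\<close>

lemma sq_dist_swap_sum:
  assumes "-1 - int k \<le> y" "y \<le> int k"
  shows "(\<Sum>b\<leftarrow>bonds k. sq_dist y (bond_swap b x) - sq_dist y x) \<le> 2"
proof -
  let ?S = "{-1 - int k..int k - 1}"
  define d where "d = real_of_int (x - y)"
  have "(\<Sum>b\<leftarrow>bonds k. sq_dist y (bond_swap b x) - sq_dist y x)
    = (\<Sum>b\<in>?S. (if b = x then 1 + 2 * d else 0) + (if b = x - 1 then 1 - 2 * d else 0))"
    unfolding sum_list_bonds
    by (intro sum.cong refl) (auto simp: sq_dist_def bond_swap_eq d_def algebra_simps power2_eq_square)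
  also have "\<dots> = (if x \<in> ?S then 1 + 2 * d else 0) + (if x - 1 \<in> ?S then 1 - 2 * d else 0)"
    by (simp add: sum.distrib)
  also have "\<dots> \<le> 2"
  proof -
    have "d \<le> 0" if "x \<in> ?S" "x - 1 \<notin> ?S" using that assms by (simp add: d_def)
    moreover have "d \<ge> 0" if "x \<notin> ?S" "x - 1 \<in> ?S" using that assms by (simp add: d_def)
    ultimately show ?thesis by auto
  qed
  finally show ?thesis .
qed

lemma sq_dist_swap_bound:
  assumes "-1 - int k \<le> y" "y \<le> int k" "b \<in> set (bonds k)"
  shows "\<bar>sq_dist y (bond_swap b x) - sq_dist y x\<bar> \<le> 4 * real k + 3"
proof (cases "x = b \<or> x = b + 1")
  case True
  then have "\<bar>sq_dist y (bond_swap b x) - sq_dist y x\<bar> = \<bar>2 * real_of_int (b - y) + 1\<bar>"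
    by (auto simp: sq_dist_def bond_swap_eq power2_eq_square algebra_simps)
  also have "2 * real_of_int (b - y) + 1 = real_of_int (2 * (b - y) + 1)" by simp
  also have "\<bar>\<dots>\<bar> \<le> real_of_int (4 * int k + 3)"
    using assms by (subst of_int_abs[symmetric], subst of_int_le_iff) (auto simp: set_bonds)
  finally show ?thesis by simp
next
  case False
  then show ?thesis by (simp add: bond_swap_eq)
qed

text \<open>The error constant of \<open>walk_op_taylor\<close> for one sweep, with the crude
  increment bound of \<open>sq_dist_swap_bound\<close>. It grows with the box, but with
  \<open>p\<close> of order 1/m it contributes only O(1/m) over m sweeps.\<close>

definition sweep_err :: "nat \<Rightarrow> real" where
  "sweep_err k = 2 * (4 * real k + 3) * (real (length (bonds k)))\<^sup>2"

text \<open>Diffusive growth: the generator adds at most \<open>2 * p\<close> per sweep. Later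
  \<open>p\<close> is at most t/(2m), so the main term over m sweeps is at most t.\<close>

lemma walk_op_sq_dist:
  assumes "-1 - int k \<le> y" "y \<le> int k" "0 \<le> p" "p \<le> 1"
  shows "walk_op p (sweeps k m) (sq_dist y) x \<le> sq_dist y x + m * (2 * p + p\<^sup>2 * sweep_err k)"
proof (induction m arbitrary: x)
  case (Suc m)
  define e where "e = 2 * p + p\<^sup>2 * sweep_err k"
  have one: "walk_op p (bonds k) (sq_dist y) x \<le> sq_dist y x + e"
  proof -
    have "walk_op p (bonds k) (sq_dist y) x
      \<le> sq_dist y x + p * (\<Sum>b\<leftarrow>bonds k. sq_dist y (bond_swap b x) - sq_dist y x) + p\<^sup>2 * sweep_err k"
      unfolding sweep_err_def using assms sq_dist_swap_bound[OF assms(1,2)]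
      by (intro order.trans[OF walk_op_taylor]) auto
    also have "p * (\<Sum>b\<leftarrow>bonds k. sq_dist y (bond_swap b x) - sq_dist y x) \<le> p * 2"
      using assms sq_dist_swap_sum by (intro mult_left_mono) auto
    finally show ?thesis by (simp add: e_def)
  qed
  have "walk_op p (sweeps k (Suc m)) (sq_dist y) x
    \<le> walk_op p (bonds k) (\<lambda>x. m * e + 1 * sq_dist y x) x"
    unfolding sweeps_Suc walk_op_append
    by (rule walk_op_mono) (use Suc assms in \<open>auto simp: e_def add.commute\<close>)
  also have "\<dots> = m * e + walk_op p (bonds k) (sq_dist y) x"
    by (subst walk_op_affine) simp
  also have "\<dots> \<le> sq_dist y x + real (Suc m) * e" using one by (simp add: algebra_simps)
  finally show ?case by (simp add: e_def)
qed simp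

section \<open>Exponential moments of the flux of the discrete dynamics\<close>

text \<open>Both sides are indexed by j in {1..K}, so that reflection takes the right site 2j - 2 to
  1 - 2j, the right neighbour of the left site -2j.\<close>

definition evens :: "nat \<Rightarrow> int set" where
  "evens K = (\<lambda>j. - 2 * int j) ` {1..K} \<union> (\<lambda>j. 2 * int j - 2) ` {1..K}"

lemma mem_evens: "x \<in> evens K \<longleftrightarrow> even x \<and> - 2 * int K \<le> x \<and> x < 2 * int K"
proof
  assume *: "even x \<and> - 2 * int K \<le> x \<and> x < 2 * int K"
  then obtain y where y: "x = 2 * y" by blast
  show "x \<in> evens K"
  proof (cases "y < 0")
    case True
    then have "x = - 2 * int (nat (- y))" "nat (- y) \<in> {1..K}" using y * by auto
    then show ?thesis unfolding evens_def by blast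
  next
    case False
    then have "x = 2 * int (nat (y + 1)) - 2" "nat (y + 1) \<in> {1..K}" using y * by auto
    then show ?thesis unfolding evens_def by blast
  qed
qed (auto simp: evens_def)

lemma finite_evens [simp]: "finite (evens K)"
  by (simp add: evens_def)

lemma sum_evens:
  "sum h (evens K) = (\<Sum>j\<in>{1..K}. h (- 2 * int j)) + (\<Sum>j\<in>{1..K}. h (2 * int j - 2))"
  for h :: "int \<Rightarrow> real"
proof -
  have inj: "inj_on (\<lambda>j. - 2 * int j) {1..K}" "inj_on (\<lambda>j. 2 * int j - 2) {1..K}"
    by (auto intro!: inj_onI)
  have "(\<lambda>j. - 2 * int j) ` {1..K} \<inter> (\<lambda>j. 2 * int j - 2) ` {1..K} = {}" by auto
  then have "sum h (evens K) = sum h ((\<lambda>j. - 2 * int j) ` {1..K}) + sum h ((\<lambda>j. 2 * int j - 2) ` {1..K})"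
    unfolding evens_def by (intro sum.union_disjoint) auto
  then show ?thesis by (simp only: sum.reindex[OF inj(1)] sum.reindex[OF inj(2)] o_def)
qed

abbreviation right_half :: "int \<Rightarrow> real" where
  "right_half x \<equiv> of_bool (0 \<le> x)"

text \<open>The two sums of the flux are merged into the net gain of the right half-line among
  particles started in \<open>evens K\<close>, so that the exponential factorises over
  particles.\<close>

definition disc_flux :: "nat \<Rightarrow> (int \<times> bool) list \<Rightarrow> real" where
  "disc_flux K ops = (\<Sum>x\<in>evens K. right_half (stir ops x) - right_half x)"

text \<open>The terms up to r, the ceiling of sqrt v, are bounded by 1, the later ones by the
  telescoping 1/j^2 <= 1/(j-1) - 1/j. The cut balances r against v/r.\<close>

lemma sum_inverse_square_tail:
  fixes a :: "nat \<Rightarrow> real"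
  assumes "1 \<le> v" "\<And>j. a j \<le> 1" "\<And>j. 1 \<le> j \<Longrightarrow> j \<le> K \<Longrightarrow> a j \<le> v / (real j)\<^sup>2"
  shows "sum a {1..K} \<le> 2 * sqrt v + 1"
proof -
  define r where "r = nat \<lceil>sqrt v\<rceil>"
  have sq: "1 \<le> sqrt v" using assms by simp
  have r: "sqrt v \<le> r" "r \<le> sqrt v + 1" unfolding r_def using sq by linarith+
  have "0 < real r" using r sq by linarith
  then have r1: "1 \<le> r" by simp
  have vr: "v / r \<le> sqrt v"
  proof -
    have "v = sqrt v * sqrt v" using assms by simp
    also have "\<dots> \<le> sqrt v * r" using r sq by (intro mult_left_mono) auto
    finally show ?thesis using r1 by (simp add: field_simps)
  qed
  show ?thesis
  proof (cases "K \<le> r")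
    case True
    have "sum a {1..K} \<le> (\<Sum>j\<in>{1..K}. 1)" by (intro sum_mono assms)
    also have "\<dots> \<le> r" using True by simp
    finally show ?thesis using r sq by linarith
  next
    case False
    then have rK: "r \<le> K" by simp
    have "n \<le> K \<longrightarrow> sum a {1..n} \<le> r + v / r - v / n" if "r \<le> n" for n
      using that
    proof (induction n rule: nat_induct_at_least)
      case base
      have "sum a {1..r} \<le> (\<Sum>j\<in>{1..r}. 1)" by (intro sum_mono assms)
      then show ?case by simp
    next
      case (Suc n)
      show ?case
      proof
        assume "Suc n \<le> K"
        have "a (Suc n) \<le> v / (real (Suc n))\<^sup>2" using \<open>Suc n \<le> K\<close> by (intro assms) auto
        also have "\<dots> \<le> v / (real n * real (Suc n))"
          using Suc r1 assms by (intro divide_left_mono mult_pos_pos) (auto simp: power2_eq_square)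
        also have "\<dots> = v / n - v / Suc n"
          using Suc r1 by (simp add: field_simps)
        finally show "sum a {1..Suc n} \<le> r + v / r - v / Suc n" using Suc \<open>Suc n \<le> K\<close> by simp
      qed
    qed
    from this[OF rK] have "sum a {1..K} \<le> r + v / r - v / K" by simp
    also have "\<dots> \<le> r + v / r" using assms by simp
    finally show ?thesis using vr r by simp
  qed
qed

lemma sum_alternating_le:
  fixes P :: "int \<Rightarrow> real"
  assumes "mono P" "\<And>x. 0 \<le> P x" "\<And>x. P x \<le> 1"
  shows "(\<Sum>j\<in>{1..K}. P (- 2 * int j)) \<le> (\<Sum>j\<in>{1..K}. P (1 - 2 * int j))"
    and "(\<Sum>j\<in>{1..K}. P (1 - 2 * int j)) \<le> (\<Sum>j\<in>{1..K}. P (- 2 * int j)) + 1"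
proof -
  show "(\<Sum>j\<in>{1..K}. P (- 2 * int j)) \<le> (\<Sum>j\<in>{1..K}. P (1 - 2 * int j))"
    by (intro sum_mono monoD[OF assms(1)]) auto
  \<comment> \<open>The term \<open>P (- 2 * int K)\<close> is kept because the next odd site lies
    just left of \<open>- 2 * int K\<close>; it absorbs the value of \<open>P\<close> there and the
    sum telescopes.\<close>
  have "(\<Sum>j\<in>{1..K}. P (1 - 2 * int j)) - (\<Sum>j\<in>{1..K}. P (- 2 * int j)) \<le> 1 - P (- 2 * int K)"
  proof (induction K)
    case (Suc K)
    have "P (1 - 2 * int (Suc K)) \<le> P (- 2 * int K)" by (rule monoD[OF assms(1)]) auto
    then show ?case using Suc by simp
  qed (use assms in simp)
  then show "(\<Sum>j\<in>{1..K}. P (1 - 2 * int j)) \<le> (\<Sum>j\<in>{1..K}. P (- 2 * int j)) + 1"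
    using assms(2)[of "- 2 * int K"] by simp
qed

text \<open>After Liggett's inequality only one-particle sums remain. By reflection symmetry the means of the
  two sums in the flux are \<open>\<Sum>P(-2j)\<close> and \<open>\<Sum>P(1-2j)\<close>; monotonicity of \<open>P\<close> interlaces them, so that they
  differ by at most 1.\<close>

lemma coin_mean_exp_disc_flux:
  assumes p: "0 \<le> p" "p \<le> 1 / 2"
    and v: "1 \<le> v" "m * (2 * p + p\<^sup>2 * sweep_err (2 * K)) \<le> v"
  shows "coin_mean p (length (sweeps (2 * K) m))
      (\<lambda>cs. exp (l * disc_flux K (zip (sweeps (2 * K) m) cs)))
    \<le> exp ((exp l + exp (- l) - 2) * (2 * sqrt v + 1) + exp \<bar>l\<bar>)"
proof -
  define bs where "bs = sweeps (2 * K) m"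
  define P where "P = walk_op p bs right_half"
  define Sp where "Sp = (\<Sum>j\<in>{1..K}. P (- 2 * int j))"
  define Sm where "Sm = (\<Sum>j\<in>{1..K}. P (1 - 2 * int j))"
  have p1: "p \<le> 1" using p by simp
  have P0: "0 \<le> P x" for x unfolding P_def using p p1 by (intro walk_op_nonneg) auto
  have P1: "P x \<le> 1" for x
    unfolding P_def using walk_op_mono[of p right_half "\<lambda>_. 1" bs x] p p1 by (simp add: walk_op_const)
  have monoP: "mono P"
    unfolding P_def using p by (intro mono_walk_op) (auto simp: mono_def)
  have P_refl: "P (-1 - x) = 1 - P x" for x
  proof -
    have "P (-1 - x) = walk_op p bs (\<lambda>x. right_half (-1 - x)) x"
      unfolding P_def bs_def by (rule walk_op_sweeps_reflect[symmetric])
    also have "(\<lambda>x. right_half (-1 - x)) = (\<lambda>x. 1 + (-1) * right_half x)"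
      by (auto simp: fun_eq_iff)
    also have "walk_op p bs \<dots> x = 1 + (-1) * P x"
      unfolding P_def by (rule walk_op_affine)
    finally show ?thesis by simp
  qed
  have Pv: "P (- 2 * int j) \<le> v / (real j)\<^sup>2" if "1 \<le> j" "j \<le> K" for j
  proof -
    define y where "y = - 2 * int j"
    have y: "y < 0" "-1 - int (2 * K) \<le> y" "y \<le> int (2 * K)" using that by (auto simp: y_def)
    \<comment> \<open>Chebyshev's inequality: from \<open>y\<close> < 0 the right half-line is at
      distance |y|, so its indicator is at most the squared distance over y^2. Here y^2 = 4 j^2, and
      the 4 is given away at the end.\<close>
    have "P y \<le> walk_op p bs (\<lambda>x. 0 + (1 / (real_of_int y)\<^sup>2) * sq_dist y x) y"
      unfolding P_def
    proof (rule walk_op_mono[OF p(1) p1])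
      fix x :: int
      have "(real_of_int y)\<^sup>2 \<le> sq_dist y x" if "0 \<le> x"
      proof -
        have "\<bar>real_of_int y\<bar> \<le> \<bar>real_of_int (x - y)\<bar>" using that y by simp
        then show ?thesis unfolding sq_dist_def by (simp only: abs_le_square_iff)
      qed
      then show "right_half x \<le> 0 + (1 / (real_of_int y)\<^sup>2) * sq_dist y x"
        using y by (auto simp: sq_dist_def)
    qed
    also have "\<dots> = 0 + (1 / (real_of_int y)\<^sup>2) * walk_op p bs (sq_dist y) y"
      by (rule walk_op_affine)
    also have "\<dots> \<le> 0 + (1 / (real_of_int y)\<^sup>2) * v"
    proof (intro add_left_mono mult_left_mono)
      have "walk_op p bs (sq_dist y) y \<le> sq_dist y y + m * (2 * p + p\<^sup>2 * sweep_err (2 * K))"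
        unfolding bs_def by (rule walk_op_sq_dist) (use y p p1 in auto)
      then show "walk_op p bs (sq_dist y) y \<le> v" using v by (simp add: sq_dist_def)
    qed simp
    also have "\<dots> \<le> v / (real j)\<^sup>2"
      using v that by (simp add: y_def field_simps)
    finally show ?thesis by (simp add: y_def)
  qed
  have Sp: "Sp \<le> 2 * sqrt v + 1"
    unfolding Sp_def using v P1 Pv by (intro sum_inverse_square_tail) auto
  have Sm: "Sp \<le> Sm" "Sm \<le> Sp + 1"
    unfolding Sp_def Sm_def using sum_alternating_le[OF monoP P0 P1] by auto
  \<comment> \<open>As \<open>right_half\<close> takes the values 0 and 1, the exponential is affine
    in it, and its one-particle mean follows from \<open>walk_op_affine\<close>.\<close>
  define g where "g = (\<lambda>y. 1 + (exp l - 1) * right_half y)"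
  have g: "exp (l * right_half y) = g y" for y by (simp add: g_def)
  have g0: "0 \<le> g y" for y using exp_ge_zero[of "l * right_half y"] unfolding g .
  \<comment> \<open>The mean of the one-particle factor minus 1. For \<open>x\<close> >= 0 the
    initial occupation brings e^-l, and the factor is recentred on the probability 1 - P x of ending
    in the left half-line.\<close>
  define r where "r x = (if x < 0 then (exp l - 1) * P x else (exp (- l) - 1) * (1 - P x))" for x
  have "exp (l * disc_flux K (zip bs cs))
      = (\<Prod>x\<in>evens K. exp (- l * right_half x)) * (\<Prod>x\<in>evens K. g (stir (zip bs cs) x))" for cs
    unfolding disc_flux_def sum_distrib_left
    by (simp add: exp_sum g[symmetric] prod.distrib[symmetric] mult_exp_exp right_diff_distrib del: of_bool_eq_0_iff)
  then have "coin_mean p (length bs) (\<lambda>cs. exp (l * disc_flux K (zip bs cs)))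
      = (\<Prod>x\<in>evens K. exp (- l * right_half x)) *
        coin_mean p (length bs) (\<lambda>cs. \<Prod>x\<in>evens K. g (stir (zip bs cs) x))"
    by (simp add: coin_mean_cmult)
  also have "\<dots> \<le> (\<Prod>x\<in>evens K. exp (- l * right_half x)) * (\<Prod>x\<in>evens K. walk_op p bs g x)"
    by (intro mult_left_mono liggett_inequality prod_nonneg) (use g0 p p1 in auto)
  also have "\<dots> = (\<Prod>x\<in>evens K. exp (- l * right_half x) * (1 + (exp l - 1) * P x))"
    unfolding g_def walk_op_affine P_def by (simp add: prod.distrib)
  also have "\<dots> \<le> (\<Prod>x\<in>evens K. exp (r x))"
  proof (intro prod_mono conjI)
    fix x
    have "0 \<le> (1 - P x) + exp l * P x" using P0[of x] P1[of x] by simp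
    also have "\<dots> = 1 + (exp l - 1) * P x" by (simp add: algebra_simps)
    finally show "0 \<le> exp (- l * right_half x) * (1 + (exp l - 1) * P x)" by simp
    have "exp (- l * right_half x) * (1 + (exp l - 1) * P x) = 1 + r x"
      by (auto simp: r_def algebra_simps mult_exp_exp simp flip: exp_add)
    also have "\<dots> \<le> exp (r x)" by (rule exp_ge_add_one_self)
    finally show "exp (- l * right_half x) * (1 + (exp l - 1) * P x) \<le> exp (r x)" .
  qed
  also have "\<dots> = exp (\<Sum>x\<in>evens K. r x)" by (simp add: exp_sum)
  also have "(\<Sum>x\<in>evens K. r x) = (exp l - 1) * Sp + (exp (- l) - 1) * Sm"
  proof -
    have 1: "(\<Sum>j\<in>{1..K}. r (- 2 * int j)) = (exp l - 1) * Sp"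
      unfolding Sp_def sum_distrib_left by (intro sum.cong) (auto simp: r_def)
    have 2: "(\<Sum>j\<in>{1..K}. r (2 * int j - 2)) = (exp (- l) - 1) * Sm"
      unfolding Sm_def sum_distrib_left
    proof (intro sum.cong refl)
      fix j assume "j \<in> {1..K}"
      then show "r (2 * int j - 2) = (exp (- l) - 1) * P (1 - 2 * int j)"
        using P_refl[of "2 * int j - 2"] by (simp add: r_def)
    qed
    show ?thesis by (simp only: sum_evens 1 2)
  qed
  also have "\<dots> = (exp l + exp (- l) - 2) * Sp + (exp (- l) - 1) * (Sm - Sp)"
    by (simp add: algebra_simps)
  also have "\<dots> \<le> (exp l + exp (- l) - 2) * (2 * sqrt v + 1) + exp \<bar>l\<bar>"
  proof (rule add_mono)
    have "exp l + exp (- l) - 2 = (exp (l / 2) - exp (- l / 2))\<^sup>2"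
      by (simp add: power2_eq_square algebra_simps mult_exp_exp)
    then have "0 \<le> exp l + exp (- l) - 2" by simp
    then show "(exp l + exp (- l) - 2) * Sp \<le> (exp l + exp (- l) - 2) * (2 * sqrt v + 1)"
      using Sp by (intro mult_left_mono)
    have "(exp (- l) - 1) * (Sm - Sp) \<le> exp (- l) * (Sm - Sp)"
      using Sm by (intro mult_right_mono) auto
    also have "\<dots> \<le> exp (- l) * 1" using Sm by (intro mult_left_mono) auto
    also have "\<dots> \<le> exp \<bar>l\<bar>" by simp
    finally show "(exp (- l) - 1) * (Sm - Sp) \<le> exp \<bar>l\<bar>" .
  qed
  finally show ?thesis by (simp add: bs_def)
qed

text \<open>For \<open>l\<close> >= 0 the left side is e^l (1 - e^-l)^2 with 1 - e^-l <= l; both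
  sides dominate the case of negative \<open>l\<close> by evenness of the left side and of the
  squared and absolute values.\<close>

lemma exp_plus_exp_minus_le: "exp l + exp (- l) - 2 \<le> l\<^sup>2 * exp \<bar>l\<bar>" for l :: real
proof -
  have *: "exp l + exp (- l) - 2 \<le> l\<^sup>2 * exp l" if "0 \<le> l" for l :: real
  proof -
    have "1 - l \<le> exp (- l)" using exp_ge_add_one_self[of "- l"] by simp
    then have "(1 - exp (- l))\<^sup>2 \<le> l\<^sup>2" using that by (intro power_mono) auto
    then have "exp l * (1 - exp (- l))\<^sup>2 \<le> exp l * l\<^sup>2" by (intro mult_left_mono) auto
    moreover have "exp l * (1 - exp (- l))\<^sup>2 = exp l + exp (- l) - 2"
      by (simp add: power2_eq_square algebra_simps mult_exp_exp flip: exp_add)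
    ultimately show ?thesis by (simp add: mult.commute)
  qed
  show ?thesis using *[of l] *[of "- l"] by (cases "0 \<le> l") auto
qed

section \<open>Paths of the stirring particles\<close>

lemma event_at_less: "event_at p u \<Longrightarrow> 0 \<le> s \<Longrightarrow> s < u \<Longrightarrow> p s < p u"
  by (auto simp: event_at_def)

text \<open>Counts are natural numbers that increase strictly from event to event, so
  \<open>p\<close> itself is injective on the events up to \<open>T\<close>, with values at most
  \<open>p T\<close>.\<close>

lemma finite_events:
  assumes "mono_on {0..} p"
  shows "finite {u. event_at p u \<and> u \<le> T}"
proof (rule inj_on_finite[where f = p and B = "{..p T}"])
  show "inj_on p {u. event_at p u \<and> u \<le> T}"
  proof (rule linorder_inj_onI')
    fix u v assume "u \<in> {u. event_at p u \<and> u \<le> T}" "v \<in> {u. event_at p u \<and> u \<le> T}" "u < v"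
    then have "p u < p v" by (intro event_at_less) (auto simp: event_at_def)
    then show "p u \<noteq> p v" by simp
  qed
  show "p ` {u. event_at p u \<and> u \<le> T} \<subseteq> {..p T}"
    using assms by (auto simp: event_at_def intro: mono_onD)
qed simp

text \<open>The event is the first time at which the count exceeds \<open>p s\<close>. The infimum
  belongs to the set because a right-continuous integer path is constant on some interval to its
  right.\<close>

lemma event_exists:
  fixes p :: "real \<Rightarrow> nat"
  assumes mono: "mono_on {0..} p" and cont: "\<And>u. 0 \<le> u \<Longrightarrow> continuous (at_right u) p"
    and "0 \<le> s" "s < T" "p s < p T"
  shows "\<exists>u. s < u \<and> u \<le> T \<and> event_at p u"
proof -
  define V where "V = {v. s \<le> v \<and> p s < p v}"
  define u where "u = Inf V"
  have TV: "T \<in> V" using assms by (simp add: V_def)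
  have bdd: "bdd_below V" by (auto simp: V_def bdd_below_def)
  have su: "s \<le> u" unfolding u_def using TV by (intro cInf_greatest) (auto simp: V_def)
  have uT: "u \<le> T" unfolding u_def using TV bdd by (rule cInf_lower)
  have below: "p v \<le> p s" if "s \<le> v" "v < u" for v
    using that cInf_lower[OF _ bdd, of v] by (force simp: V_def u_def)
  have "((\<lambda>v. p v) \<longlongrightarrow> p u) (at_right u)" using cont[of u] su assms by (simp add: continuous_within)
  then have "eventually (\<lambda>v. p v = p u) (at_right u)" by (simp add: tendsto_discrete)
  then obtain d where d: "u < d" "\<And>v. u < v \<Longrightarrow> v < d \<Longrightarrow> p v = p u"
    unfolding eventually_at_right_field by blast
  obtain v where v: "v \<in> V" "v < d"
    using d(1) TV bdd cInf_less_iff[of V d] by (auto simp: u_def)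
  have "u \<le> v" unfolding u_def using v bdd by (intro cInf_lower)
  then have "p v = p u" using d(2)[of v] v by (cases "u = v") auto
  then have pu: "p s < p u" using v by (simp add: V_def)
  then have "s < u" using su by (cases "s = u") auto
  moreover have "event_at p u"
    unfolding event_at_def
  proof (intro conjI ballI)
    show "0 < u" using \<open>s < u\<close> assms by simp
    fix v assume v: "v \<in> {0..<u}"
    show "p v < p u"
    proof (cases "s \<le> v")
      case True
      then show ?thesis using below[of v] v pu by simp
    next
      case False
      then have "p v \<le> p s" using mono v assms by (intro mono_onD[OF mono]) auto
      then show ?thesis using pu by simp
    qed
  qed
  ultimately show ?thesis using uT by blast
qed

lemma stir_unmoved:
  assumes "\<And>b c. (b, c) \<in> set ops \<Longrightarrow> b = y \<or> b = y - 1 \<Longrightarrow> \<not> c"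
  shows "stir ops y = y"
  using assms
proof (induction ops)
  case (Cons op ops)
  obtain b c where op: "op = (b, c)" by fastforce
  have "(if c then bond_swap b y else y) = y"
    using Cons.prems[of b c] by (auto simp: op bond_swap_eq)
  then show ?case using Cons by (auto simp: op)
qed simp

lemma stir_no_flips:
  assumes "\<And>b c. (b, c) \<in> set ops \<Longrightarrow> \<not> c"
  shows "stir ops y = y"
  using assms by (intro stir_unmoved) blast

text \<open>With a single flip the order of the bonds in a sweep is invisible; this allows the
  symmetric order to be compared with the true order of events.\<close>

lemma stir_single_flip:
  assumes "distinct bs" "e \<in> set bs" "h e" "\<And>b. b \<in> set bs \<Longrightarrow> b \<noteq> e \<Longrightarrow> \<not> h b"
  shows "stir (map (\<lambda>b. (b, h b)) bs) y = bond_swap e y"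
proof -
  obtain us vs where bs: "bs = us @ e # vs" using assms by (meson split_list)
  have "\<not> h b" if "b \<in> set us \<union> set vs" for b using assms that by (auto simp: bs)
  then have "stir (map (\<lambda>b. (b, h b)) us) z = z" "stir (map (\<lambda>b. (b, h b)) vs) z = z" for z
    by (auto intro!: stir_no_flips)
  then show ?thesis using assms(3) by (simp add: bs stir_append)
qed

text \<open>Only a performed swap at \<open>b\<close> carries a particle between \<open>b\<close>
  and \<open>b + 1\<close>, so a bond that never flips separates the line.\<close>

lemma stir_barrier:
  assumes "(b, True) \<notin> set ops"
  shows "b < stir ops x \<longleftrightarrow> b < x"
  using assms
proof (induction ops arbitrary: x)
  case (Cons op ops)
  obtain b' c where op: "op = (b', c)" by fastforce
  have "b < (if c then bond_swap b' x else x) \<longleftrightarrow> b < x"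
    using Cons.prems by (auto simp: op bond_swap_eq)
  then show ?case using Cons by (auto simp: op)
qed simp

definition grid :: "real \<Rightarrow> nat \<Rightarrow> nat \<Rightarrow> real" where
  "grid t m i = real i * (t / real m)"

lemma grid_0 [simp]: "grid t m 0 = 0"
  and grid_end: "m \<noteq> 0 \<Longrightarrow> grid t m m = t"
  by (simp_all add: grid_def)

lemma grid_nonneg: "0 \<le> t \<Longrightarrow> 0 \<le> grid t m i"
  by (simp add: grid_def)

lemma strict_mono_grid: "0 < t \<Longrightarrow> m \<noteq> 0 \<Longrightarrow> strict_mono (grid t m)"
  by (auto simp: grid_def strict_mono_def simp del: times_divide_eq_right intro!: mult_strict_right_mono divide_pos_pos)

lemma grid_Suc_diff: "grid t m (Suc i) - grid t m i = t / m"
  by (simp add: grid_def algebra_simps add_divide_distrib)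

definition hit :: "(int \<Rightarrow> real \<Rightarrow> nat) \<Rightarrow> real \<Rightarrow> nat \<Rightarrow> nat \<Rightarrow> int \<Rightarrow> bool" where
  "hit n t m i b \<longleftrightarrow> n b (grid t m i) < n b (grid t m (Suc i))"

text \<open>\<open>List.product\<close> exhausts the bonds for one time cell before passing to the
  next, so each cell yields one sweep.\<close>

definition grid_ops :: "(int \<Rightarrow> real \<Rightarrow> nat) \<Rightarrow> real \<Rightarrow> nat \<Rightarrow> nat \<Rightarrow> nat \<Rightarrow> (int \<times> bool) list" where
  "grid_ops n t m k j = map (\<lambda>(i, b). (b, hit n t m i b)) (List.product [0..<j] (bonds k))"

lemma grid_ops_0 [simp]: "grid_ops n t m k 0 = []"
  by (simp add: grid_ops_def)

lemma product_append_left: "List.product (xs @ ys) zs = List.product xs zs @ List.product ys zs"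
  by (induction xs) simp_all

lemma grid_ops_Suc: "grid_ops n t m k (Suc j) = grid_ops n t m k j @ map (\<lambda>b. (b, hit n t m j b)) (bonds k)"
  by (simp add: grid_ops_def product_append_left)

section \<open>Stirring paths for a fixed realisation of the clocks\<close>

text \<open>Collects path properties that hold almost surely, so that the comparison is purely
  deterministic. \<open>later\<close> gives each bond an event after \<open>t\<close>, which keeps
  the set whose infimum defines the next jump nonempty from any time up to \<open>t\<close>.\<close>

locale clock_paths =
  fixes n :: "int \<Rightarrow> real \<Rightarrow> nat" and t :: real
  assumes t_pos: "0 < t"
    and mono_path: "\<And>b. mono_on {0..} (n b)"
    and cont_path: "\<And>b u. 0 \<le> u \<Longrightarrow> continuous (at_right u) (n b)"
    and later: "\<And>b. \<exists>T>t. n b t < n b T"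
begin

definition jumps :: "int \<Rightarrow> real set" where
  "jumps y = {u. event_at (n y) u \<or> event_at (n (y - 1)) u}"

text \<open>Some event \<open>w\<close> lies beyond \<open>t\<close>, and only finitely many events
  precede it; the infimum is therefore a minimum, hence a genuine event time.\<close>

lemma next_jump:
  fixes y :: int
  assumes "0 \<le> s" "s \<le> t"
  defines "u \<equiv> Inf {u. s < u \<and> (event_at (n y) u \<or> event_at (n (y - 1)) u)}"
  shows "s < u" "u \<in> jumps y" "\<And>v. v \<in> jumps y \<Longrightarrow> s < v \<Longrightarrow> u \<le> v"
proof -
  let ?E = "{u. s < u \<and> (event_at (n y) u \<or> event_at (n (y - 1)) u)}"
  obtain T where T: "T > t" "n y t < n y T" using later by blast
  then obtain w where w: "t < w" "event_at (n y) w"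
    using event_exists[OF mono_path cont_path _ T] t_pos by force
  define F where "F = ?E \<inter> {..w}"
  have fin: "finite F"
    by (rule finite_subset[OF _ finite_UnI[OF finite_events[OF mono_path, of y w]
          finite_events[OF mono_path, of "y - 1" w]]]) (auto simp: F_def)
  have wF: "w \<in> F" using w assms by (auto simp: F_def)
  then have ne: "F \<noteq> {}" by blast
  have MinE: "Min F \<in> ?E" using Min_in[OF fin ne] by (simp add: F_def)
  have Min_le: "Min F \<le> v" if "v \<in> ?E" for v
  proof (cases "v \<le> w")
    case True
    then show ?thesis using that fin by (intro Min_le) (auto simp: F_def)
  next
    case False
    then show ?thesis using Min_le[OF fin wF] by simp
  qed
  have "u = Min F" unfolding u_def using MinE Min_le by (intro cInf_eq_minimum) auto
  then show "s < u" "u \<in> jumps y" "\<And>v. v \<in> jumps y \<Longrightarrow> s < v \<Longrightarrow> u \<le> v"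
    using MinE Min_le by (auto simp: jumps_def)
qed

abbreviation time :: "int \<Rightarrow> nat \<Rightarrow> real" where "time x k \<equiv> fst (stirring_step n x k)"
abbreviation pos :: "int \<Rightarrow> nat \<Rightarrow> int" where "pos x k \<equiv> snd (stirring_step n x k)"

text \<open>\<open>later\<close> controls the recursion only from times up to \<open>t\<close>; this
  guard ensures that every step so far, and the next one, is a true jump.\<close>

definition alive :: "int \<Rightarrow> nat \<Rightarrow> bool" where
  "alive x k \<longleftrightarrow> (\<forall>i\<le>k. time x i \<le> t)"

lemma alive_0 [simp]: "alive x 0"
  using t_pos by (simp add: alive_def)

lemma alive_Suc: "alive x (Suc k) \<longleftrightarrow> alive x k \<and> time x (Suc k) \<le> t"
  by (auto simp: alive_def le_Suc_eq)

lemma time_Suc: "time x (Suc k) = Inf {u. time x k < u \<and> (event_at (n (pos x k)) u \<or> event_at (n (pos x k - 1)) u)}"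
  and pos_Suc: "pos x (Suc k) =
    (if event_at (n (pos x k)) (time x (Suc k)) then pos x k + 1 else pos x k - 1)"
  by (simp_all add: Let_def case_prod_beta)

declare stirring_step.simps(2) [simp del]

lemma time_nonneg: "alive x k \<Longrightarrow> 0 \<le> time x k"
proof (induction k)
  case (Suc k)
  then have "time x k < time x (Suc k)"
    unfolding time_Suc by (intro next_jump(1)) (auto simp: alive_Suc, simp add: alive_def)
  then show ?case using Suc by (simp add: alive_Suc)
qed simp

lemma
  assumes "alive x k"
  shows time_less: "time x k < time x (Suc k)"
    and time_jump: "time x (Suc k) \<in> jumps (pos x k)"
    and time_le_jump: "\<And>v. v \<in> jumps (pos x k) \<Longrightarrow> time x k < v \<Longrightarrow> time x (Suc k) \<le> v"
proof -
  have "0 \<le> time x k" "time x k \<le> t" using assms time_nonneg by (auto simp: alive_def)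
  from next_jump[OF this, where y = "pos x k"] show "time x k < time x (Suc k)"
    "time x (Suc k) \<in> jumps (pos x k)"
    "\<And>v. v \<in> jumps (pos x k) \<Longrightarrow> time x k < v \<Longrightarrow> time x (Suc k) \<le> v"
    unfolding time_Suc by auto
qed

lemma stirring_eq:
  assumes "alive x k" "t < time x (Suc k)"
  shows "stirring n x t = pos x k"
proof -
  have "(LEAST k. t < time x (Suc k)) = k"
  proof (rule Least_equality)
    fix j assume j: "t < time x (Suc j)"
    show "k \<le> j"
    proof (rule ccontr)
      assume "\<not> k \<le> j"
      then have "time x (Suc j) \<le> t" using assms(1) by (simp add: alive_def)
      with j show False by simp
    qed
  qed fact
  then show ?thesis by (simp add: stirring_def)
qed

text \<open>For nondecreasing natural counts a zero at \<open>t\<close> forces zero on all of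
  [0, t], so one value of the clock expresses the absence of events.\<close>

definition quiet :: "int \<Rightarrow> bool" where "quiet b \<longleftrightarrow> n b t = 0"

lemma quiet_no_event:
  assumes "quiet b" "u \<le> t"
  shows "\<not> event_at (n b) u"
proof
  assume *: "event_at (n b) u"
  then have "n b 0 < n b u" by (auto simp: event_at_def)
  also have "n b u \<le> n b t"
    using assms * by (intro mono_onD[OF mono_path]) (auto simp: event_at_def)
  finally show False using assms by (simp add: quiet_def)
qed

lemma quiet_not_hit:
  assumes "quiet b" "i < m"
  shows "\<not> hit n t m i b"
proof -
  have "grid t m (Suc i) \<le> grid t m m"
    using strict_mono_grid[of t m] t_pos assms by (simp add: strict_mono_less_eq)
  then have "n b (grid t m (Suc i)) \<le> n b t"
    using t_pos assms by (intro mono_onD[OF mono_path]) (auto simp: grid_nonneg grid_end)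
  then show ?thesis using assms by (simp add: hit_def quiet_def)
qed

lemma pos_barrier:
  assumes "quiet b" "alive x k"
  shows "b < pos x k \<longleftrightarrow> b < x"
  using assms(2)
proof (induction k)
  case (Suc k)
  then have k: "alive x k" "time x (Suc k) \<le> t" by (auto simp: alive_Suc)
  have "pos x k \<noteq> b" if "event_at (n (pos x k)) (time x (Suc k))"
    using that quiet_no_event[OF assms(1) k(2)] by auto
  moreover have "pos x k - 1 \<noteq> b" if "\<not> event_at (n (pos x k)) (time x (Suc k))"
    using that time_jump[OF k(1)] quiet_no_event[OF assms(1) k(2)] by (auto simp: jumps_def)
  ultimately show ?case using Suc.IH[OF k(1)] by (auto simp: pos_Suc)
qed simp

text \<open>Between two quiet bonds the particle uses the events of finitely many bonds up to
  \<open>t\<close>. These are finitely many, while its jump times increase strictly.\<close>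

lemma finitely_many_steps:
  assumes "quiet b1" "quiet b2" "b1 < x" "x \<le> b2"
  shows "\<exists>k. alive x k \<and> t < time x (Suc k)"
proof (rule ccontr)
  assume *: "\<not> ?thesis"
  have alive: "alive x k" for k
  proof (induction k)
    case (Suc k)
    then show ?case using * by (auto simp: alive_Suc not_less)
  qed simp
  define F where "F = (\<Union>b\<in>{b1..b2}. {u. event_at (n b) u \<and> u \<le> t})"
  have "finite F" unfolding F_def by (intro finite_UN_I finite_events mono_path) auto
  moreover have "range (\<lambda>k. time x (Suc k)) \<subseteq> F"
  proof safe
    fix k
    have "b1 < pos x k" using pos_barrier[OF assms(1) alive] assms by simp
    moreover have "pos x k \<le> b2" using pos_barrier[OF assms(2) alive[of k]] assms by auto
    moreover have "time x (Suc k) \<le> t" using alive[of "Suc k"] by (simp add: alive_def)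
    ultimately show "time x (Suc k) \<in> F"
      using time_jump[OF alive[of k]] unfolding F_def jumps_def
      by (auto intro: bexI[of _ "pos x k"] bexI[of _ "pos x k - 1"])
  qed
  moreover have "inj (\<lambda>k. time x (Suc k))"
    by (intro strict_mono_imp_inj_on strict_monoI_Suc time_less alive)
  ultimately show False
    by (meson finite_imageD finite_subset infinite_UNIV_nat)
qed

lemma stirring_barrier:
  assumes "quiet b1" "quiet b2" "b1 < x" "x \<le> b2" "quiet b"
  shows "b < stirring n x t \<longleftrightarrow> b < x"
proof -
  obtain k where k: "alive x k" "t < time x (Suc k)" using finitely_many_steps[OF assms(1-4)] by blast
  then show ?thesis using pos_barrier[OF assms(5) k(1)] by (simp add: stirring_eq)
qed

text \<open>The invariant at a grid time names the jump index \<open>i\<close> current there. In the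
  next cell either neither bond next to the particle is hit and the sweep fixes it, or exactly one
  jump occurs and the sweep is that single swap. The barriers keep the particle and both its bonds
  inside the box.\<close>

lemma stirring_eq_stir:
  assumes simple: "\<And>i b. i < m \<Longrightarrow> b \<in> set (bonds k) \<Longrightarrow> n b (grid t m (Suc i)) \<le> n b (grid t m i) + 1"
    and disj: "\<And>i b b'. i < m \<Longrightarrow> b \<in> set (bonds k) \<Longrightarrow> b' \<in> set (bonds k) \<Longrightarrow>
      hit n t m i b \<Longrightarrow> hit n t m i b' \<Longrightarrow> b = b'"
    and b: "quiet b1" "quiet b2" "b1 < x" "x \<le> b2" "b1 \<in> set (bonds k)" "b2 \<in> set (bonds k)"
    and m: "m \<noteq> 0"
  shows "stirring n x t = stir (grid_ops n t m k m) x"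
proof -
  note sm = strict_mono_grid[OF t_pos m]
  have grid_le: "grid t m i \<le> t" if "i \<le> m" for i
    using that sm m by (metis grid_end strict_mono_less_eq)
  have hitI: "hit n t m j e" if "event_at (n e) u" "grid t m j < u" "u \<le> grid t m (Suc j)" for j e u
  proof -
    have "n e (grid t m j) < n e u" using that t_pos by (intro event_at_less) (auto simp: grid_nonneg)
    also have "n e u \<le> n e (grid t m (Suc j))"
      using that by (intro mono_onD[OF mono_path]) (auto simp: event_at_def)
    finally show ?thesis by (simp add: hit_def)
  qed
  have "j \<le> m \<longrightarrow> (\<exists>i. alive x i \<and> time x i \<le> grid t m j \<and> grid t m j < time x (Suc i) \<and>
    pos x i = stir (grid_ops n t m k j) x)" for j
  proof (induction j)
    case 0
    show ?case
      using time_less[of x 0] by (intro impI exI[of _ 0]) auto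
  next
    case (Suc j)
    show ?case
    proof
      assume jm: "Suc j \<le> m"
      then obtain i where i: "alive x i" "time x i \<le> grid t m j" "grid t m j < time x (Suc i)"
        "pos x i = stir (grid_ops n t m k j) x" using Suc by auto
      define y where "y = pos x i"
      define u where "u = time x (Suc i)"
      have in_box: "pos x i' \<in> set (bonds k) \<and> pos x i' - 1 \<in> set (bonds k)" if "alive x i'" for i'
        using pos_barrier[OF b(1) that] pos_barrier[OF b(2) that] b by (auto simp: set_bonds)
      have y_box: "y \<in> set (bonds k)" "y - 1 \<in> set (bonds k)" using in_box[OF i(1)] by (auto simp: y_def)
      let ?sweep = "map (\<lambda>b. (b, hit n t m j b)) (bonds k)"
      have sweep: "stir (grid_ops n t m k (Suc j)) x = stir ?sweep y"
        by (simp add: grid_ops_Suc stir_append y_def i)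
      show "\<exists>i. alive x i \<and> time x i \<le> grid t m (Suc j) \<and> grid t m (Suc j) < time x (Suc i) \<and>
        pos x i = stir (grid_ops n t m k (Suc j)) x"
      proof (cases "grid t m (Suc j) < u")
        case True
        have nohit: "\<not> hit n t m j b" if "b = y \<or> b = y - 1" for b
        proof
          assume "hit n t m j b"
          then obtain v where v: "grid t m j < v" "v \<le> grid t m (Suc j)" "event_at (n b) v"
            using event_exists[OF mono_path cont_path, where s = "grid t m j" and T = "grid t m (Suc j)"]
              sm t_pos
            by (metis grid_nonneg hit_def lessI less_eq_real_def strict_mono_less)
          then have "v \<in> jumps y" using that by (auto simp: jumps_def)
          then have "u \<le> v" using time_le_jump[OF i(1), of v] v i by (simp add: u_def y_def)
          then show False using v True by simp
        qed
        have "stir ?sweep y = y" using nohit by (intro stir_unmoved) auto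
        moreover have "time x i \<le> grid t m (Suc j)"
          using i(2) sm by (meson lessI less_imp_le order_trans strict_mono_less)
        ultimately show ?thesis using i True sweep by (intro exI[of _ i]) (auto simp: u_def y_def)
      next
        case False
        define e where "e = (if event_at (n y) u then y else y - 1)"
        have e: "event_at (n e) u" using time_jump[OF i(1)] by (auto simp: e_def jumps_def u_def y_def)
        have e_box: "e \<in> set (bonds k)" using y_box by (simp add: e_def)
        have hit_e: "hit n t m j e" using hitI[OF e] i False by (simp add: u_def)
        have only: "b = e" if "b \<in> set (bonds k)" "hit n t m j b" for b
          using disj[of j b e] jm that e_box hit_e by simp
        have pos': "pos x (Suc i) = bond_swap e y"
          by (auto simp: pos_Suc e_def u_def y_def bond_swap_eq)
        have "stir ?sweep y = bond_swap e y"
          by (rule stir_single_flip[OF distinct_bonds e_box]) (use only hit_e in auto)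
        then have pos: "pos x (Suc i) = stir (grid_ops n t m k (Suc j)) x" using sweep pos' by simp
        have alive': "alive x (Suc i)"
          using i(1) False grid_le[OF jm] by (auto simp: alive_Suc u_def)
        define v where "v = time x (Suc (Suc i))"
        have uv: "u < v" using time_less[OF alive'] by (simp add: u_def v_def)
        \<comment> \<open>A second jump in the cell would by \<open>disj\<close> use the same bond
          \<open>e\<close>, which would then have two events in one cell, contrary to
          \<open>simple\<close>.\<close>
        have "grid t m (Suc j) < v"
        proof (rule ccontr)
          assume nv: "\<not> grid t m (Suc j) < v"
          obtain e' where e': "e' = pos x (Suc i) \<or> e' = pos x (Suc i) - 1" "event_at (n e') v"
            using time_jump[OF alive'] by (auto simp: jumps_def v_def)
          have "e' \<in> set (bonds k)" using in_box[OF alive'] e' by auto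
          moreover have "hit n t m j e'" using hitI[OF e'(2)] nv uv i by (simp add: u_def)
          ultimately have "e' = e" by (rule only)
          have "n e (grid t m j) < n e u"
            using e i t_pos by (intro event_at_less) (auto simp: grid_nonneg u_def)
          moreover have "n e u < n e v"
            using e e' \<open>e' = e\<close> uv by (intro event_at_less) (auto simp: event_at_def)
          moreover have "n e v \<le> n e (grid t m (Suc j))"
            using nv e' \<open>e' = e\<close> by (intro mono_onD[OF mono_path]) (auto simp: event_at_def)
          moreover have "n e (grid t m (Suc j)) \<le> n e (grid t m j) + 1"
            using simple[of j e] jm e_box by simp
          ultimately show False by linarith
        qed
        then show ?thesis
          using alive' pos False by (intro exI[of _ "Suc i"]) (auto simp: u_def v_def)
      qed
    qed
  qed
  from this[of m] obtain i where "alive x i" "t < time x (Suc i)" "pos x i = stir (grid_ops n t m k m) x"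
    using m by (auto simp: grid_end)
  then show ?thesis using stirring_eq by metis
qed

text \<open>Between the barriers both dynamics move a particle alike; beyond them it stays on its
  side of the barrier, hence of the origin, in both. \<open>far\<close> places every starting point
  between two quiet bonds, so that each true path has finitely many jumps up to
  \<open>t\<close>.\<close>

lemma flux_eq_disc_flux:
  assumes simple: "\<And>i b. i < m \<Longrightarrow> b \<in> set (bonds (2 * K)) \<Longrightarrow> n b (grid t m (Suc i)) \<le> n b (grid t m i) + 1"
    and disj: "\<And>i b b'. i < m \<Longrightarrow> b \<in> set (bonds (2 * K)) \<Longrightarrow> b' \<in> set (bonds (2 * K)) \<Longrightarrow>
      hit n t m i b \<Longrightarrow> hit n t m i b' \<Longrightarrow> b = b'"
    and b: "quiet b1" "quiet b2" "- 2 * int K \<le> b1" "b1 < -1" "0 \<le> b2" "b2 < 2 * int K"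
    and far: "\<And>B. \<exists>b\<ge>B. quiet b" "\<And>B. \<exists>b\<le>B. quiet b"
    and m: "m \<noteq> 0"
  shows "flux (\<lambda>x. of_bool (even x)) n t = disc_flux K (grid_ops n t m (2 * K) m)"
proof -
  define D where "D = stir (grid_ops n t m (2 * K) m)"
  have noflip: "(b, True) \<notin> set (grid_ops n t m (2 * K) m)" if "quiet b" for b
    using quiet_not_hit[OF that] by (auto simp: grid_ops_def)
  have bar: "c < stirring n x t \<longleftrightarrow> c < x" if "quiet c" for c x
  proof -
    obtain a a' where "quiet a" "a \<le> x - 1" "quiet a'" "x \<le> a'" using far by blast
    then show ?thesis using stirring_barrier[of a a' x c] that by simp
  qed
  have D: "0 \<le> stirring n x t \<longleftrightarrow> 0 \<le> D x" for x
  proof -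
    consider "x \<le> b1" | "b1 < x" "x \<le> b2" | "b2 < x" by linarith
    then show ?thesis
    proof cases
      case 1
      then have "stirring n x t \<le> b1" "D x \<le> b1"
        using bar[OF b(1), of x] stir_barrier[OF noflip[OF b(1)], of x] by (auto simp: D_def)
      then show ?thesis using b by auto
    next
      case 2
      have "stirring n x t = D x"
        unfolding D_def
        by (rule stirring_eq_stir[OF simple disj b(1,2) 2 _ _ m]) (use b in \<open>auto simp: set_bonds\<close>)
      then show ?thesis by simp
    next
      case 3
      then have "b2 < stirring n x t" "b2 < D x"
        using bar[OF b(2), of x] stir_barrier[OF noflip[OF b(2)], of x] by (auto simp: D_def)
      then show ?thesis using b by auto
    qed
  qed
  \<comment> \<open>This fact and the next make all terms of the two infinite sums outside
    \<open>evens K\<close> vanish, so each \<open>infsum\<close> is a finite sum.\<close>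
  have left: "D x < 0" if "x \<le> b1" for x
    using that stir_barrier[OF noflip[OF b(1)], of x] b by (auto simp: D_def)
  have right: "0 \<le> D x" if "b2 < x" for x
    using that stir_barrier[OF noflip[OF b(2)], of x] b by (auto simp: D_def)
  let ?A = "evens K"
  have "(\<Sum>\<^sub>\<infinity>x\<in>{..<0}. of_bool (even x) * of_bool (stirring n x t \<ge> 0))
      = (\<Sum>\<^sub>\<infinity>x\<in>?A \<inter> {..<0}. right_half (D x))"
    by (rule infsum_cong_neutral) (use left b in \<open>auto simp: mem_evens D not_le intro!: left\<close>)
  also have "\<dots> = (\<Sum>x\<in>?A \<inter> {..<0}. right_half (D x))" by simp
  finally have 1: "(\<Sum>\<^sub>\<infinity>x\<in>{..<0}. of_bool (even x) * of_bool (stirring n x t \<ge> 0))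
      = (\<Sum>x\<in>?A \<inter> {..<0}. right_half (D x))" .
  have "(\<Sum>\<^sub>\<infinity>x\<in>{0..}. of_bool (even x) * of_bool (stirring n x t < 0))
      = (\<Sum>\<^sub>\<infinity>x\<in>?A \<inter> {0..}. 1 - right_half (D x))"
    by (rule infsum_cong_neutral) (use right b in \<open>auto simp: mem_evens D not_le[symmetric] intro!: right\<close>)
  also have "\<dots> = (\<Sum>x\<in>?A \<inter> {0..}. 1 - right_half (D x))" by simp
  finally have 2: "(\<Sum>\<^sub>\<infinity>x\<in>{0..}. of_bool (even x) * of_bool (stirring n x t < 0))
      = (\<Sum>x\<in>?A \<inter> {0..}. 1 - right_half (D x))" .
  have "disc_flux K (grid_ops n t m (2 * K) m)
    = (\<Sum>x\<in>(?A \<inter> {..<0}) \<union> (?A \<inter> {0..}). right_half (D x) - right_half x)"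
    unfolding disc_flux_def D_def by (intro sum.cong) auto
  also have "\<dots> = (\<Sum>x\<in>?A \<inter> {..<0}. right_half (D x) - right_half x)
      + (\<Sum>x\<in>?A \<inter> {0..}. right_half (D x) - right_half x)"
    by (intro sum.union_disjoint) auto
  also have "(\<Sum>x\<in>?A \<inter> {..<0}. right_half (D x) - right_half x) = (\<Sum>x\<in>?A \<inter> {..<0}. right_half (D x))"
    by (intro sum.cong) auto
  also have "(\<Sum>x\<in>?A \<inter> {0..}. right_half (D x) - right_half x) = - (\<Sum>x\<in>?A \<inter> {0..}. 1 - right_half (D x))"
    unfolding sum_negf[symmetric] by (intro sum.cong) auto
  finally show ?thesis unfolding flux_def 1 2 by simp
qed

end

section \<open>Independent clocks\<close>

lemma coin_mean_eq_sum:
  "coin_mean p l F = (\<Sum>cs | length cs = l. F cs * (\<Prod>c\<leftarrow>cs. if c then p else 1 - p))"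
proof (induction l arbitrary: F)
  case (Suc l)
  have "finite {cs :: bool list. length cs = l}"
    using finite_lists_length_eq[of "UNIV :: bool set" l] by simp
  moreover have "{cs :: bool list. length cs = Suc l} =
      (#) False ` {cs. length cs = l} \<union> (#) True ` {cs. length cs = l}"
    by (force simp: length_Suc_conv image_iff)
  moreover have "inj_on ((#) b) A" for b :: bool and A by simp
  ultimately show ?case
    by (subst \<open>{cs :: bool list. length cs = Suc l} = _\<close>, subst sum.union_disjoint)
      (auto simp: sum.reindex Suc sum_distrib_left algebra_simps)
qed simp

text \<open>A variable with finitely many values only needs its level sets to be events; its mean is
  then the weighted finite sum that \<open>coin_mean\<close> computes.\<close>

lemma (in prob_space) coin_mean_eq_expectation:
  assumes meas: "\<And>cs. length cs = l \<Longrightarrow> {\<omega>\<in>space M. X \<omega> = cs} \<in> events"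
    and len: "\<And>\<omega>. length (X \<omega>) = l"
    and prob: "\<And>cs. length cs = l \<Longrightarrow>
      prob {\<omega>\<in>space M. X \<omega> = cs} = (\<Prod>c\<leftarrow>cs. if c then p else 1 - p)"
  shows "(\<lambda>\<omega>. F (X \<omega>) :: real) \<in> borel_measurable M"
    and "integrable M (\<lambda>\<omega>. F (X \<omega>))"
    and "expectation (\<lambda>\<omega>. F (X \<omega>)) = coin_mean p l F"
proof -
  let ?L = "{cs :: bool list. length cs = l}"
  let ?E = "\<lambda>cs. {\<omega>\<in>space M. X \<omega> = cs}"
  have fin: "finite ?L" using finite_lists_length_eq[of "UNIV :: bool set" l] by simp
  have eq: "F (X \<omega>) = (\<Sum>cs\<in>?L. F cs * indicator (?E cs) \<omega>)" if "\<omega> \<in> space M" for \<omega>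
  proof -
    have "(\<Sum>cs\<in>?L. F cs * indicator (?E cs) \<omega>) = (\<Sum>cs\<in>?L. if cs = X \<omega> then F cs else 0)"
      using that by (intro sum.cong) (auto simp: indicator_def)
    then show ?thesis using fin len by simp
  qed
  have int: "integrable M (\<lambda>\<omega>. \<Sum>cs\<in>?L. F cs * indicator (?E cs) \<omega>)"
    using meas by (intro Bochner_Integration.integrable_sum integrable_mult_right
        integrable_real_indicator) (auto simp: emeasure_eq_measure)
  then show int': "integrable M (\<lambda>\<omega>. F (X \<omega>))"
    by (subst Bochner_Integration.integrable_cong[OF refl eq]) auto
  then show "(\<lambda>\<omega>. F (X \<omega>)) \<in> borel_measurable M" by (rule borel_measurable_integrable)
  have "expectation (\<lambda>\<omega>. F (X \<omega>)) = expectation (\<lambda>\<omega>. \<Sum>cs\<in>?L. F cs * indicator (?E cs) \<omega>)"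
    by (intro Bochner_Integration.integral_cong refl eq)
  also have "\<dots> = (\<Sum>cs\<in>?L. F cs * prob (?E cs))"
    using meas by (subst Bochner_Integration.integral_sum)
      (auto intro!: integrable_real_indicator integrable_mult_right sum.cong simp: emeasure_eq_measure Int_absorb2)
  also have "\<dots> = coin_mean p l F"
    unfolding coin_mean_eq_sum using prob by (intro sum.cong) auto
  finally show "expectation (\<lambda>\<omega>. F (X \<omega>)) = coin_mean p l F" .
qed

lemma less_sets:
  fixes X Y :: "'a \<Rightarrow> nat"
  assumes "X \<in> measurable A (count_space UNIV)" "Y \<in> measurable A (count_space UNIV)"
  shows "{x\<in>space A. (X x < Y x) = c} \<in> sets A"
proof -
  have [measurable]: "X \<in> borel_measurable A" "Y \<in> borel_measurable A"
    using assms measurable_compose[OF _ borel_measurable_count_space[of "\<lambda>x. x"]] by auto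
  have "{x\<in>space A. X x < Y x} \<in> sets A" "{x\<in>space A. \<not> X x < Y x} \<in> sets A"
    by measurable
  then show ?thesis by (cases c) simp_all
qed

locale poisson_clocks = prob_space M for M :: "'w measure" +
  fixes N :: "int \<Rightarrow> real \<Rightarrow> 'w \<Rightarrow> nat"
  assumes clocks: "independent_poisson_processes M (1 / 2) N"
begin

lemma clock: "poisson_process M (1 / 2) (N b)"
  using clocks by (simp add: independent_poisson_processes_def)

lemma N_measurable [measurable]: "0 \<le> s \<Longrightarrow> N b s \<in> measurable M (count_space UNIV)"
  using clock[of b] unfolding poisson_process_def by blast

lemma N_zero: "\<omega> \<in> space M \<Longrightarrow> N b 0 \<omega> = 0"
  and N_mono: "\<omega> \<in> space M \<Longrightarrow> mono_on {0..} (\<lambda>s. N b s \<omega>)"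
  and N_cont: "\<omega> \<in> space M \<Longrightarrow> 0 \<le> s \<Longrightarrow> continuous (at_right s) (\<lambda>s. N b s \<omega>)"
  using clock[of b] unfolding poisson_process_def by blast+

lemma N_distr: "0 \<le> s \<Longrightarrow> s < u \<Longrightarrow>
    distr M (count_space UNIV) (\<lambda>\<omega>. N b u \<omega> - N b s \<omega>) = measure_pmf (poisson_pmf ((u - s) / 2))"
  using clock[of b] unfolding poisson_process_def by simp

lemma N_prob:
  assumes "0 \<le> s" "s < u"
  shows "prob {\<omega>\<in>space M. N b u \<omega> - N b s \<omega> \<in> A} = measure_pmf.prob (poisson_pmf ((u - s) / 2)) A"
proof -
  have [measurable]: "N b s \<in> measurable M (count_space UNIV)" "N b u \<in> measurable M (count_space UNIV)"
    using assms by auto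
  have "measure_pmf.prob (poisson_pmf ((u - s) / 2)) A =
    measure (distr M (count_space UNIV) (\<lambda>\<omega>. N b u \<omega> - N b s \<omega>)) A"
    using N_distr[OF assms] by simp
  also have "\<dots> = prob ((\<lambda>\<omega>. N b u \<omega> - N b s \<omega>) -` A \<inter> space M)"
    by (rule measure_distr) auto
  also have "(\<lambda>\<omega>. N b u \<omega> - N b s \<omega>) -` A \<inter> space M = {\<omega>\<in>space M. N b u \<omega> - N b s \<omega> \<in> A}" by auto
  finally show ?thesis ..
qed

lemma N_prob_no_event:
  assumes "0 \<le> s" "s < u"
  shows "prob {\<omega>\<in>space M. \<not> N b s \<omega> < N b u \<omega>} = exp (- ((u - s) / 2))"
proof -
  \<comment> \<open>Subtraction of naturals truncates, so the difference is 0 exactly when the count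
    does not increase.\<close>
  have "{\<omega>\<in>space M. \<not> N b s \<omega> < N b u \<omega>} = {\<omega>\<in>space M. N b u \<omega> - N b s \<omega> \<in> {0}}" by auto
  then have "prob {\<omega>\<in>space M. \<not> N b s \<omega> < N b u \<omega>} = measure_pmf.prob (poisson_pmf ((u - s) / 2)) {0}"
    using N_prob[OF assms, of b "{0}"] by simp
  then show ?thesis using assms by (simp add: measure_pmf_single)
qed

lemma N_prob_event:
  assumes "0 \<le> s" "s < u"
  shows "prob {\<omega>\<in>space M. N b s \<omega> < N b u \<omega>} = 1 - exp (- ((u - s) / 2))"
proof -
  have "{\<omega>\<in>space M. (N b s \<omega> < N b u \<omega>) = False} \<in> events"
    using assms by (intro less_sets) auto
  then have "prob {\<omega>\<in>space M. \<not> \<not> N b s \<omega> < N b u \<omega>} = 1 - prob {\<omega>\<in>space M. \<not> N b s \<omega> < N b u \<omega>}"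
    by (intro prob_neg) simp
  then show ?thesis using N_prob_no_event[OF assms] by simp
qed

text \<open>With r the mean of the increment, at most one event has probability (1 + r) e^-r >= (1 +
  r)(1 - r) = 1 - r^2.\<close>

lemma N_prob_two_events:
  assumes "0 \<le> s" "s < u"
  shows "prob {\<omega>\<in>space M. N b s \<omega> + 1 < N b u \<omega>} \<le> ((u - s) / 2)\<^sup>2"
proof -
  define r where "r = (u - s) / 2"
  have r: "0 < r" using assms by (simp add: r_def)
  have "{\<omega>\<in>space M. N b s \<omega> + 1 < N b u \<omega>} = {\<omega>\<in>space M. N b u \<omega> - N b s \<omega> \<in> - {0, 1}}" by auto
  then have "prob {\<omega>\<in>space M. N b s \<omega> + 1 < N b u \<omega>} = measure_pmf.prob (poisson_pmf r) (- {0, 1})"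
    using N_prob[OF assms, of b "- {0, 1}"] by (simp add: r_def)
  also have "\<dots> = 1 - measure_pmf.prob (poisson_pmf r) {0, 1}"
    using measure_pmf.prob_compl[of "{0, 1}" "poisson_pmf r"] by (simp add: Compl_eq_Diff_UNIV)
  also have "measure_pmf.prob (poisson_pmf r) {0, 1} = (1 + r) * exp (- r)"
    using r by (subst measure_measure_pmf_finite) (auto simp: algebra_simps)
  also have "1 - (1 + r) * exp (- r) \<le> 1 - (1 + r) * (1 - r)"
    using r exp_ge_add_one_self[of "- r"] by (intro diff_left_mono mult_left_mono) auto
  also have "\<dots> = r\<^sup>2" by (simp add: algebra_simps power2_eq_square)
  finally show ?thesis by (simp add: r_def)
qed

lemma indep_across_bonds:
  assumes "finite B" "B \<noteq> {}"
    and A: "\<And>b. b \<in> B \<Longrightarrow> A b \<in> sets (PiM {0..} (\<lambda>_. count_space UNIV))"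
  shows "prob (\<Inter>b\<in>B. {\<omega>\<in>space M. (\<lambda>s\<in>{0..}. N b s \<omega>) \<in> A b})
    = (\<Prod>b\<in>B. prob {\<omega>\<in>space M. (\<lambda>s\<in>{0..}. N b s \<omega>) \<in> A b})"
proof -
  have "indep_vars (\<lambda>_. PiM {0..} (\<lambda>_. count_space UNIV)) (\<lambda>b \<omega>. \<lambda>s\<in>{0..}. N b s \<omega>) UNIV"
    using clocks by (simp add: independent_poisson_processes_def)
  from indep_varsD[OF this assms(2,1) _ A]
  have "prob (\<Inter>b\<in>B. (\<lambda>\<omega>. \<lambda>s\<in>{0..}. N b s \<omega>) -` A b \<inter> space M)
    = (\<Prod>b\<in>B. prob ((\<lambda>\<omega>. \<lambda>s\<in>{0..}. N b s \<omega>) -` A b \<inter> space M))" by simp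
  moreover have "(\<lambda>\<omega>. \<lambda>s\<in>{0..}. N b s \<omega>) -` A b \<inter> space M = {\<omega>\<in>space M. (\<lambda>s\<in>{0..}. N b s \<omega>) \<in> A b}" for b
    by auto
  ultimately show ?thesis by (simp only:)
qed

lemma indep_across_times:
  assumes "strict_mono \<tau>" "0 \<le> \<tau> 0" "m \<noteq> 0"
  shows "prob (\<Inter>i\<in>{..<m}. {\<omega>\<in>space M. (N b (\<tau> i) \<omega> < N b (\<tau> (Suc i)) \<omega>) = c i})
    = (\<Prod>i<m. prob {\<omega>\<in>space M. (N b (\<tau> i) \<omega> < N b (\<tau> (Suc i)) \<omega>) = c i})"
proof -
  have "indep_vars (\<lambda>_. count_space UNIV) (\<lambda>i \<omega>. N b (\<tau> (Suc i)) \<omega> - N b (\<tau> i) \<omega>) UNIV"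
    using clock[of b] assms unfolding poisson_process_def by blast
  from indep_varsD[OF this, of "{..<m}" "\<lambda>i. {k. (0 < k) = c i}"] assms(3)
  have "prob (\<Inter>i\<in>{..<m}. (\<lambda>\<omega>. N b (\<tau> (Suc i)) \<omega> - N b (\<tau> i) \<omega>) -` {k. (0 < k) = c i} \<inter> space M)
    = (\<Prod>i<m. prob ((\<lambda>\<omega>. N b (\<tau> (Suc i)) \<omega> - N b (\<tau> i) \<omega>) -` {k. (0 < k) = c i} \<inter> space M))" by auto
  moreover have "(\<lambda>\<omega>. N b (\<tau> (Suc i)) \<omega> - N b (\<tau> i) \<omega>) -` {k. (0 < k) = c i} \<inter> space M
    = {\<omega>\<in>space M. (N b (\<tau> i) \<omega> < N b (\<tau> (Suc i)) \<omega>) = c i}" for i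
    by auto
  ultimately show ?thesis by (simp only:)
qed

section \<open>Law of the discretised coins\<close>

lemma path_event_measurable:
  assumes "0 \<le> s" "0 \<le> u"
  shows "{f \<in> space (PiM {0::real..} (\<lambda>_. count_space (UNIV :: nat set))). (f s < f u) = c}
    \<in> sets (PiM {0..} (\<lambda>_. count_space UNIV))"
  using assms by (intro less_sets measurable_component_singleton) auto

definition flip_prob :: "real \<Rightarrow> nat \<Rightarrow> real" where
  "flip_prob t m = 1 - exp (- (t / m / 2))"

abbreviation hits :: "real \<Rightarrow> nat \<Rightarrow> 'w \<Rightarrow> nat \<Rightarrow> int \<Rightarrow> bool" where
  "hits t m \<omega> i b \<equiv> hit (\<lambda>b s. N b s \<omega>) t m i b"

lemma grid_measurable [measurable]: "0 < t \<Longrightarrow> N b (grid t m i) \<in> measurable M (count_space UNIV)"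
  by (intro N_measurable grid_nonneg) simp

lemma hits_measurable [measurable]: "0 < t \<Longrightarrow> {\<omega>\<in>space M. hits t m \<omega> i b = c} \<in> events"
  unfolding hit_def by (intro less_sets grid_measurable)

lemma grid_less_Suc: "0 < t \<Longrightarrow> m \<noteq> 0 \<Longrightarrow> grid t m i < grid t m (Suc i)"
  using strict_mono_grid[of t m] by (simp add: strict_mono_less)

lemma prob_hit:
  assumes "0 < t" "m \<noteq> 0"
  shows "prob {\<omega>\<in>space M. hits t m \<omega> i b = c} = (if c then flip_prob t m else 1 - flip_prob t m)"
proof -
  have "0 \<le> grid t m i" using assms by (simp add: grid_nonneg)
  note P = N_prob_event[OF this grid_less_Suc[OF assms]] N_prob_no_event[OF this grid_less_Suc[OF assms]]
  show ?thesis using P by (cases c) (simp_all add: hit_def flip_prob_def grid_Suc_diff)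
qed

text \<open>Two layers of independence: whole paths of different bonds, tested on sets that look at
  finitely many grid times, and then increments of one clock over successive cells.\<close>

lemma prob_hits:
  assumes t: "0 < t" "m \<noteq> 0" and B: "finite B" "B \<noteq> {}"
  shows "prob {\<omega>\<in>space M. \<forall>b\<in>B. \<forall>i<m. hits t m \<omega> i b = c i b}
    = (\<Prod>b\<in>B. \<Prod>i<m. if c i b then flip_prob t m else 1 - flip_prob t m)"
proof -
  let ?P = "PiM {0::real..} (\<lambda>_. count_space (UNIV :: nat set))"
  define A where "A b = (\<Inter>i\<in>{..<m}. {f \<in> space ?P. (f (grid t m i) < f (grid t m (Suc i))) = c i b})" for b
  have g0: "0 \<le> grid t m i" for i using t by (simp add: grid_nonneg)
  have A: "A b \<in> sets ?P" for b
    unfolding A_def using t by (intro sets.finite_INT path_event_measurable g0) auto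
  have in_A: "(\<lambda>s\<in>{0..}. N b s \<omega>) \<in> A b \<longleftrightarrow> (\<forall>i<m. hits t m \<omega> i b = c i b)" for b \<omega>
    using g0 by (auto simp: A_def hit_def space_PiM)
  have "prob {\<omega>\<in>space M. \<forall>b\<in>B. \<forall>i<m. hits t m \<omega> i b = c i b}
    = prob (\<Inter>b\<in>B. {\<omega>\<in>space M. (\<lambda>s\<in>{0..}. N b s \<omega>) \<in> A b})"
    using B unfolding in_A by (intro arg_cong[where f = prob]) auto
  also have "\<dots> = (\<Prod>b\<in>B. prob {\<omega>\<in>space M. (\<lambda>s\<in>{0..}. N b s \<omega>) \<in> A b})"
    by (rule indep_across_bonds[OF B A])
  also have "\<dots> = (\<Prod>b\<in>B. \<Prod>i<m. if c i b then flip_prob t m else 1 - flip_prob t m)"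
  proof (intro prod.cong refl)
    fix b
    have "{\<omega>\<in>space M. (\<lambda>s\<in>{0..}. N b s \<omega>) \<in> A b} =
        (\<Inter>i\<in>{..<m}. {\<omega>\<in>space M. (N b (grid t m i) \<omega> < N b (grid t m (Suc i)) \<omega>) = c i b})"
      unfolding in_A hit_def using t by auto
    then have "prob {\<omega>\<in>space M. (\<lambda>s\<in>{0..}. N b s \<omega>) \<in> A b}
        = (\<Prod>i<m. prob {\<omega>\<in>space M. (N b (grid t m i) \<omega> < N b (grid t m (Suc i)) \<omega>) = c i b})"
      using indep_across_times[OF strict_mono_grid[OF t], of m b "\<lambda>i. c i b"] t by simp
    also have "\<dots> = (\<Prod>i<m. if c i b then flip_prob t m else 1 - flip_prob t m)"
      using prob_hit[OF t, of _ b] unfolding hit_def by (intro prod.cong refl)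
    finally show "prob {\<omega>\<in>space M. (\<lambda>s\<in>{0..}. N b s \<omega>) \<in> A b}
        = (\<Prod>i<m. if c i b then flip_prob t m else 1 - flip_prob t m)" .
  qed
  finally show ?thesis .
qed

lemma sweeps_eq: "sweeps k m = map snd (List.product [0..<m] (bonds k))"
proof (induction m)
  case (Suc m)
  have "sweeps k (Suc m) = sweeps k m @ bonds k"
    by (simp add: sweeps_def replicate_append_same[symmetric] del: replicate.simps)
      (metis append_Nil2 concat.simps concat_append replicate_Suc replicate_append_same)
  then show ?case by (simp add: Suc product_append_left o_def)
qed simp

definition flips :: "real \<Rightarrow> nat \<Rightarrow> nat \<Rightarrow> 'w \<Rightarrow> bool list" where
  "flips t m k \<omega> = map (\<lambda>(i, b). hits t m \<omega> i b) (List.product [0..<m] (bonds k))"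

lemma grid_ops_eq: "grid_ops (\<lambda>b s. N b s \<omega>) t m k m = zip (sweeps k m) (flips t m k \<omega>)"
  by (simp add: grid_ops_def sweeps_eq flips_def zip_map_map zip_same_conv_map case_prod_beta)

lemma length_flips: "length (flips t m k \<omega>) = length (sweeps k m)"
  by (simp add: flips_def sweeps_eq)

lemma
  assumes t: "0 < t" "m \<noteq> 0" and len: "length cs = length (sweeps k m)"
  shows flips_measurable: "{\<omega>\<in>space M. flips t m k \<omega> = cs} \<in> events"
    and prob_flips: "prob {\<omega>\<in>space M. flips t m k \<omega> = cs}
      = (\<Prod>c\<leftarrow>cs. if c then flip_prob t m else 1 - flip_prob t m)"
proof -
  define ps where "ps = List.product [0..<m] (bonds k)"
  \<comment> \<open>Reads the coin list as a table indexed by cell and bond; the entries of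
    \<open>ps\<close> are distinct, so each coin has its own place.\<close>
  define c where "c i b = the (map_of (zip ps cs) (i, b))" for i b
  have dps: "distinct ps" by (simp add: ps_def distinct_product distinct_bonds)
  have lps: "length ps = length cs" using len by (simp add: sweeps_eq ps_def)
  have sps: "set ps = {..<m} \<times> set (bonds k)" by (auto simp: ps_def)
  have cs: "cs = map (\<lambda>(i, b). c i b) ps"
    using lps dps by (intro nth_equalityI) (auto simp: c_def map_of_zip_nth)
  have eq: "flips t m k \<omega> = cs \<longleftrightarrow> (\<forall>b\<in>set (bonds k). \<forall>i<m. hits t m \<omega> i b = c i b)" for \<omega>
    unfolding flips_def ps_def[symmetric] by (subst cs) (auto simp: sps)
  show "{\<omega>\<in>space M. flips t m k \<omega> = cs} \<in> events"
    unfolding eq using t by measurable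
  have "prob {\<omega>\<in>space M. flips t m k \<omega> = cs}
    = (\<Prod>b\<in>set (bonds k). \<Prod>i<m. if c i b then flip_prob t m else 1 - flip_prob t m)"
    unfolding eq by (rule prob_hits[OF t]) (auto simp: set_bonds)
  also have "\<dots> = (\<Prod>x\<in>set ps. if (case x of (i, b) \<Rightarrow> c i b) then flip_prob t m else 1 - flip_prob t m)"
    unfolding sps by (subst prod.swap) (simp add: prod.cartesian_product case_prod_beta)
  also have "\<dots> = (\<Prod>c\<leftarrow>cs. if c then flip_prob t m else 1 - flip_prob t m)"
    by (subst cs) (simp add: prod.distinct_set_conv_list[OF dps] o_def)
  finally show "prob {\<omega>\<in>space M. flips t m k \<omega> = cs}
      = (\<Prod>c\<leftarrow>cs. if c then flip_prob t m else 1 - flip_prob t m)" .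
qed

section \<open>Almost sure events and crowded cells\<close>

lemma prob_all_jump:
  assumes "0 < t" "finite B"
  shows "prob {\<omega>\<in>space M. \<forall>b\<in>B. N b t \<omega> \<noteq> 0} = (1 - exp (- (t / 2))) ^ card B"
proof (cases "B = {}")
  case False
  let ?P = "PiM {0::real..} (\<lambda>_. count_space (UNIV :: nat set))"
  let ?A = "{f \<in> space ?P. (f 0 < f t) = True}"
  have A: "?A \<in> sets ?P" using assms by (intro path_event_measurable) auto
  have in_A: "{\<omega>\<in>space M. (\<lambda>s\<in>{0..}. N b s \<omega>) \<in> ?A} = {\<omega>\<in>space M. N b 0 \<omega> < N b t \<omega>}" for b
    using assms by (auto simp: space_PiM)
  have "{\<omega>\<in>space M. \<forall>b\<in>B. N b t \<omega> \<noteq> 0} = (\<Inter>b\<in>B. {\<omega>\<in>space M. N b 0 \<omega> < N b t \<omega>})"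
    using False by (auto simp: N_zero)
  also have "prob \<dots> = (\<Prod>b\<in>B. prob {\<omega>\<in>space M. N b 0 \<omega> < N b t \<omega>})"
    using indep_across_bonds[OF assms(2) False A] unfolding in_A .
  also have "\<dots> = (1 - exp (- (t / 2))) ^ card B"
    using N_prob_event[of 0 t] assms by simp
  finally show ?thesis .
qed (simp add: prob_space)

text \<open>Bonds are independent, each active with the same probability q < 1. An infinite
  \<open>S\<close> contains r bonds for every r, and these are all active with probability
  q^r.\<close>

lemma AE_quiet_bond:
  assumes t: "0 < t" and S: "infinite S"
  shows "AE \<omega> in M. \<exists>b\<in>S. N b t \<omega> = 0"
proof -
  define Z where "Z = {\<omega>\<in>space M. \<forall>b\<in>S. N b t \<omega> \<noteq> 0}"
  have [measurable]: "N b t \<in> measurable M (count_space UNIV)" for b using t by simp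
  have Z_sets: "Z \<in> events" unfolding Z_def by measurable
  define q where "q = 1 - exp (- (t / 2))"
  have q: "0 \<le> q" "q < 1" using t by (auto simp: q_def)
  have "prob Z \<le> q ^ r" for r
  proof -
    obtain B where B: "finite B" "card B = r" "B \<subseteq> S"
      using infinite_arbitrarily_large[OF S] by blast
    have "prob Z \<le> prob {\<omega>\<in>space M. \<forall>b\<in>B. N b t \<omega> \<noteq> 0}"
    proof (rule finite_measure_mono)
      show "{\<omega>\<in>space M. \<forall>b\<in>B. N b t \<omega> \<noteq> 0} \<in> events" by measurable
    qed (use B in \<open>auto simp: Z_def\<close>)
    then show ?thesis using prob_all_jump[OF t B(1)] B by (simp add: q_def)
  qed
  moreover have "(\<lambda>r. q ^ r) \<longlonglongrightarrow> 0" using q by (intro LIMSEQ_power_zero) auto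
  ultimately have "prob Z \<le> 0" by (intro LIMSEQ_le_const) auto
  then have "emeasure M Z = 0" by (simp add: emeasure_eq_measure measure_le_0_iff)
  then show ?thesis
    using Z_sets by (intro AE_I'[of Z]) (auto simp: Z_def null_sets_def)
qed

text \<open>The horizon moves out along integers, so that the exceptional set is a countable
  intersection; the chance of no event in r + 1 further time units decays geometrically.\<close>

lemma AE_later_event:
  assumes t: "0 < t"
  shows "AE \<omega> in M. \<exists>T>t. N b t \<omega> < N b T \<omega>"
proof -
  define Z where "Z = {\<omega>\<in>space M. \<forall>r::nat. (N b t \<omega> < N b (t + Suc r) \<omega>) = False}"
  have "Z = (\<Inter>r::nat. {\<omega>\<in>space M. (N b t \<omega> < N b (t + Suc r) \<omega>) = False})" by (auto simp: Z_def)
  also have "\<dots> \<in> events"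
  proof -
    have "{\<omega>\<in>space M. (N b t \<omega> < N b (t + Suc r) \<omega>) = False} \<in> events" for r
      using t by (intro less_sets N_measurable) auto
    then show ?thesis by (intro sets.countable_INT image_subsetI) auto
  qed
  finally have Z_sets: "Z \<in> events" .
  have bound: "prob Z \<le> exp (- (1 / 2)) ^ Suc r" for r
  proof -
    have "{\<omega>\<in>space M. (N b t \<omega> < N b (t + Suc r) \<omega>) = False} \<in> events"
      using t by (intro less_sets N_measurable) auto
    then have "prob Z \<le> prob {\<omega>\<in>space M. \<not> N b t \<omega> < N b (t + Suc r) \<omega>}"
      by (intro finite_measure_mono) (auto simp: Z_def)
    also have "\<dots> = exp (- (real (Suc r) / 2))" using N_prob_no_event[of t "t + Suc r" b] t by simp
    also have "\<dots> = exp (real (Suc r) * (- (1 / 2)))" by simp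
    also have "\<dots> = exp (- (1 / 2)) ^ Suc r" by (rule exp_of_nat_mult)
    finally show ?thesis .
  qed
  have lim: "(\<lambda>r. exp (- (1 / 2)) ^ Suc r) \<longlonglongrightarrow> (0::real)"
    by (intro LIMSEQ_Suc LIMSEQ_power_zero) auto
  have "prob Z \<le> 0" by (rule LIMSEQ_le_const[OF lim]) (use bound in blast)
  then have "emeasure M Z = 0" by (simp add: emeasure_eq_measure measure_le_0_iff)
  then have "AE \<omega> in M. \<exists>r. N b t \<omega> < N b (t + Suc r) \<omega>"
    using Z_sets by (intro AE_I'[of Z]) (auto simp: Z_def null_sets_def)
  then show ?thesis
  proof eventually_elim
    case (elim \<omega>)
    then obtain r where "N b t \<omega> < N b (t + Suc r) \<omega>" by blast
    then show ?case by (intro exI[of _ "t + Suc r"]) auto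
  qed
qed

text \<open>The complement supplies the hypotheses \<open>simple\<close> and \<open>disj\<close> of
  the pathwise comparison. The form \<open>= True\<close> matches \<open>less_sets\<close> and
  \<open>hits_measurable\<close>.\<close>

definition crowded :: "real \<Rightarrow> nat \<Rightarrow> nat \<Rightarrow> 'w set" where
  "crowded t m k =
    (\<Union>(i, b)\<in>{..<m} \<times> set (bonds k).
      {\<omega>\<in>space M. (N b (grid t m i) \<omega> + 1 < N b (grid t m (Suc i)) \<omega>) = True}) \<union>
    (\<Union>(i, b, b')\<in>{..<m} \<times> {(b, b'). b \<in> set (bonds k) \<and> b' \<in> set (bonds k) \<and> b \<noteq> b'}.
      {\<omega>\<in>space M. hits t m \<omega> i b = True \<and> hits t m \<omega> i b' = True})"

lemma flip_prob_bounds: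
  assumes "0 < t" "m \<noteq> 0"
  shows "0 \<le> flip_prob t m" "flip_prob t m \<le> t / m / 2"
  using assms exp_ge_add_one_self[of "- (t / m / 2)"] by (auto simp: flip_prob_def)

lemma prob_two_hits:
  assumes t: "0 < t" "m \<noteq> 0" and "b \<noteq> b'"
  shows "prob {\<omega>\<in>space M. hits t m \<omega> i b = True \<and> hits t m \<omega> i b' = True} \<le> (t / m / 2)\<^sup>2"
proof -
  let ?P = "PiM {0::real..} (\<lambda>_. count_space (UNIV :: nat set))"
  let ?A = "{f \<in> space ?P. (f (grid t m i) < f (grid t m (Suc i))) = True}"
  have g0: "0 \<le> grid t m i" for i using t by (simp add: grid_nonneg)
  have A: "?A \<in> sets ?P" by (intro path_event_measurable g0)
  have in_A: "{\<omega>\<in>space M. (\<lambda>s\<in>{0..}. N b s \<omega>) \<in> ?A} = {\<omega>\<in>space M. hits t m \<omega> i b = True}" for b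
    using g0 by (auto simp: space_PiM hit_def)
  have "{\<omega>\<in>space M. hits t m \<omega> i b = True \<and> hits t m \<omega> i b' = True}
    = (\<Inter>b\<in>{b, b'}. {\<omega>\<in>space M. hits t m \<omega> i b = True})" by auto
  also have "prob \<dots> = (\<Prod>b\<in>{b, b'}. prob {\<omega>\<in>space M. hits t m \<omega> i b = True})"
    using indep_across_bonds[of "{b, b'}" "\<lambda>_. ?A", OF _ _ A] unfolding in_A by simp
  also have "\<dots> = (flip_prob t m)\<^sup>2"
    using prob_hit[OF t, of i _ True] assms(3) by (simp add: power2_eq_square)
  also have "\<dots> \<le> (t / m / 2)\<^sup>2" using flip_prob_bounds[OF t] by (intro power_mono) auto
  finally show ?thesis .
qed

lemma crowded_sets:
  assumes "0 < t"
  shows "crowded t m k \<in> events"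
proof -
  have m1: "{\<omega>\<in>space M. (N b (grid t m i) \<omega> + 1 < N b (grid t m (Suc i)) \<omega>) = True} \<in> events"
    for b i
    by (intro less_sets measurable_compose[OF grid_measurable] grid_measurable assms) auto
  have "{(b, b'). b \<in> set (bonds k) \<and> b' \<in> set (bonds k) \<and> b \<noteq> b'} \<subseteq> set (bonds k) \<times> set (bonds k)"
    by auto
  then have "finite {(b, b'). b \<in> set (bonds k) \<and> b' \<in> set (bonds k) \<and> b \<noteq> b'}"
    by (rule finite_subset) simp
  moreover have "{\<omega>\<in>space M. hits t m \<omega> i b = True \<and> hits t m \<omega> i b' = True} \<in> events" for i b b'
    using assms by (intro sets.sets_Collect_conj hits_measurable)
  ultimately show ?thesis
    unfolding crowded_def by (intro sets.Un sets.finite_UN) (use m1 in auto)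
qed

text \<open>Each of the m cells has at most L + L^2 bad configurations, every one of probability at
  most (t/(2m))^2; for a fixed box the union bound is O(1/m).\<close>

lemma prob_crowded:
  assumes t: "0 < t" "m \<noteq> 0"
  shows "prob (crowded t m k) \<le> (real (length (bonds k)))\<^sup>2 * t\<^sup>2 / m"
proof -
  define L where "L = length (bonds k)"
  define e where "e = (t / m / 2)\<^sup>2"
  have e: "0 \<le> e" by (simp add: e_def)
  have cardL: "card (set (bonds k)) = L" by (simp add: L_def distinct_card distinct_bonds)
  have L1: "1 \<le> L" unfolding L_def by (cases k) auto
  let ?S = "{..<m} \<times> set (bonds k)"
  let ?Q = "{(b, b'). b \<in> set (bonds k) \<and> b' \<in> set (bonds k) \<and> b \<noteq> b'}"
  let ?T = "{..<m} \<times> ?Q"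
  have Qsub: "?Q \<subseteq> set (bonds k) \<times> set (bonds k)" by auto
  have finQ: "finite ?Q" by (rule finite_subset[OF Qsub]) simp
  have cardQ: "card ?Q \<le> L * L" using card_mono[OF _ Qsub] cardL by (simp add: card_cartesian_product)
  have g0: "0 \<le> grid t m i" for i using t by (simp add: grid_nonneg)
  have m1: "{\<omega>\<in>space M. (N b (grid t m i) \<omega> + 1 < N b (grid t m (Suc i)) \<omega>) = True} \<in> events" for b i
    by (intro less_sets measurable_compose[OF grid_measurable] grid_measurable t) auto
  have m2: "{\<omega>\<in>space M. hits t m \<omega> i b = True \<and> hits t m \<omega> i b' = True} \<in> events" for i b b'
    using t by (intro sets.sets_Collect_conj hits_measurable)
  have A: "prob (\<Union>(i, b)\<in>?S. {\<omega>\<in>space M. (N b (grid t m i) \<omega> + 1 < N b (grid t m (Suc i)) \<omega>) = True})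
    \<le> real (m * L) * e"
  proof -
    have "prob (\<Union>(i, b)\<in>?S. {\<omega>\<in>space M. (N b (grid t m i) \<omega> + 1 < N b (grid t m (Suc i)) \<omega>) = True})
      \<le> (\<Sum>x\<in>?S. prob (case x of (i, b) \<Rightarrow> {\<omega>\<in>space M. (N b (grid t m i) \<omega> + 1 < N b (grid t m (Suc i)) \<omega>) = True}))"
      by (intro measure_UNION_le) (use m1 in auto)
    also have "\<dots> \<le> (\<Sum>x\<in>?S. e)"
    proof (intro sum_mono, clarify)
      fix i b
      show "prob {\<omega>\<in>space M. (N b (grid t m i) \<omega> + 1 < N b (grid t m (Suc i)) \<omega>) = True} \<le> e"
        using N_prob_two_events[OF g0 grid_less_Suc[OF t], of b i]
        by (simp add: e_def grid_Suc_diff)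
    qed
    also have "\<dots> = real (m * L) * e" by (simp add: card_cartesian_product cardL)
    finally show ?thesis .
  qed
  have B: "prob (\<Union>(i, b, b')\<in>?T. {\<omega>\<in>space M. hits t m \<omega> i b = True \<and> hits t m \<omega> i b' = True})
    \<le> real (m * (L * L)) * e"
  proof -
    have "prob (\<Union>(i, b, b')\<in>?T. {\<omega>\<in>space M. hits t m \<omega> i b = True \<and> hits t m \<omega> i b' = True})
      \<le> (\<Sum>x\<in>?T. prob (case x of (i, b, b') \<Rightarrow> {\<omega>\<in>space M. hits t m \<omega> i b = True \<and> hits t m \<omega> i b' = True}))"
      by (intro measure_UNION_le) (use m2 finQ in auto)
    also have "\<dots> \<le> (\<Sum>x\<in>?T. e)"
      unfolding e_def by (intro sum_mono, clarify) (rule prob_two_hits[OF t])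
    also have "\<dots> = real (m * card ?Q) * e" by (simp add: card_cartesian_product)
    also have "\<dots> \<le> real (m * (L * L)) * e"
    proof (intro mult_right_mono e)
      have "m * card ?Q \<le> m * (L * L)" using cardQ by (rule mult_left_mono) simp
      then show "real (m * card ?Q) \<le> real (m * (L * L))" by (simp only: of_nat_le_iff)
    qed
    finally show ?thesis .
  qed
  have "prob (crowded t m k) \<le> real (m * L) * e + real (m * (L * L)) * e"
    unfolding crowded_def
    by (rule order.trans[OF measure_Un_le add_mono[OF A B]])
      (use m1 m2 finQ in \<open>auto intro!: sets.finite_UN\<close>)
  also have "\<dots> \<le> real (m * (L * L)) * e + real (m * (L * L)) * e"
  proof (intro add_mono mult_right_mono e order_refl)
    have "m * L \<le> m * (L * L)" using L1 by simp
    then show "real (m * L) \<le> real (m * (L * L))" by (simp only: of_nat_le_iff)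
  qed
  also have "\<dots> = (real L)\<^sup>2 * t\<^sup>2 / m / 2"
    using t by (simp add: e_def power2_eq_square field_simps)
  also have "\<dots> \<le> (real L)\<^sup>2 * t\<^sup>2 / m"
  proof -
    have "x / 2 \<le> x" if "0 \<le> x" for x :: real using that by simp
    from this[of "(real L)\<^sup>2 * t\<^sup>2 / m"] show ?thesis by simp
  qed
  finally show ?thesis by (simp add: L_def)
qed

section \<open>Passage from the discrete dynamics to the true flux\<close>

text \<open>The two confining bonds depend on the realisation but not on K, so all large boxes
  contain them; Borel-Cantelli excludes crowded cells for all large K.\<close>

lemma flux_eq_disc_flux_eventually:
  assumes t: "0 < t" and m: "\<And>K. m K \<noteq> 0"
    and summable: "summable (\<lambda>K. prob (crowded t (m K) (2 * K)))"
  shows "AE \<omega> in M. \<forall>\<^sub>F K in sequentially.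
    alternating_flux N t \<omega> = disc_flux K (zip (sweeps (2 * K) (m K)) (flips t (m K) (2 * K) \<omega>))"
proof -
  have "AE \<omega> in M. \<forall>B::int. \<exists>b\<in>{B..}. N b t \<omega> = 0"
    unfolding AE_all_countable by (intro allI AE_quiet_bond t infinite_Ici)
  moreover have "AE \<omega> in M. \<forall>B::int. \<exists>b\<in>{..B}. N b t \<omega> = 0"
    unfolding AE_all_countable by (intro allI AE_quiet_bond t infinite_Iic)
  moreover have "AE \<omega> in M. \<forall>b. \<exists>T>t. N b t \<omega> < N b T \<omega>"
    unfolding AE_all_countable by (intro allI AE_later_event t)
  moreover have "AE \<omega> in M. \<forall>\<^sub>F K in sequentially. \<omega> \<in> space M - crowded t (m K) (2 * K)"
    using summable t by (intro borel_cantelli_AE1 crowded_sets) (auto simp: emeasure_eq_measure)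
  ultimately show ?thesis
  proof eventually_elim
    case (elim \<omega>)
    have \<omega>: "\<omega> \<in> space M" using eventually_happens[OF elim(4)] by auto
    interpret clock_paths "\<lambda>b s. N b s \<omega>" t
    proof unfold_locales
      show "\<exists>T>t. N b t \<omega> < N b T \<omega>" for b using elim(3) by blast
    qed (fact t N_mono[OF \<omega>] N_cont[OF \<omega>])+
    obtain b1 where b1: "quiet b1" "b1 \<le> -2" using elim(2) by (auto simp: quiet_def)
    obtain b2 where b2: "quiet b2" "0 \<le> b2" using elim(1) by (auto simp: quiet_def)
    have far: "\<exists>b\<ge>B. quiet b" "\<exists>b\<le>B. quiet b" for B
      using elim(1,2) by (auto simp: quiet_def Bex_def)
    from elim(4) eventually_ge_at_top[of "nat (\<bar>b1\<bar> + \<bar>b2\<bar> + 1)"] show ?case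
    proof eventually_elim
      case (elim K)
      have "flux (\<lambda>x. of_bool (even x)) (\<lambda>b s. N b s \<omega>) t
        = disc_flux K (grid_ops (\<lambda>b s. N b s \<omega>) t (m K) (2 * K) (m K))"
      proof (rule flux_eq_disc_flux[OF _ _ b1(1) b2(1) _ _ _ _ far m])
        fix i b assume "i < m K" "b \<in> set (bonds (2 * K))"
        then show "N b (grid t (m K) (Suc i)) \<omega> \<le> N b (grid t (m K) i) \<omega> + 1"
          using elim(1) \<omega> by (force simp: crowded_def)
      next
        fix i b b' assume "i < m K" "b \<in> set (bonds (2 * K))" "b' \<in> set (bonds (2 * K))"
          "hits t (m K) \<omega> i b" "hits t (m K) \<omega> i b'"
        then show "b = b'"
          using elim(1) \<omega> by (force simp: crowded_def)
      qed (use elim(2) b1 b2 in auto)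
      then show ?case by (simp add: alternating_flux_def grid_ops_eq)
    qed
  qed
qed

lemma expectation_exp_disc_flux:
  assumes t: "0 < t" "m \<noteq> 0"
  shows "(\<lambda>\<omega>. exp (l * disc_flux K (zip (sweeps k m) (flips t m k \<omega>)))) \<in> borel_measurable M"
    and "(\<integral>\<^sup>+\<omega>. ennreal (exp (l * disc_flux K (zip (sweeps k m) (flips t m k \<omega>)))) \<partial>M)
      = ennreal (coin_mean (flip_prob t m) (length (sweeps k m))
          (\<lambda>cs. exp (l * disc_flux K (zip (sweeps k m) cs))))"
proof -
  note E = coin_mean_eq_expectation[where X = "flips t m k" and p = "flip_prob t m"
      and l = "length (sweeps k m)" and F = "\<lambda>cs. exp (l * disc_flux K (zip (sweeps k m) cs))",
      OF flips_measurable[OF t] length_flips prob_flips[OF t]]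
  show "(\<lambda>\<omega>. exp (l * disc_flux K (zip (sweeps k m) (flips t m k \<omega>)))) \<in> borel_measurable M"
    by (rule E(1))
  show "(\<integral>\<^sup>+\<omega>. ennreal (exp (l * disc_flux K (zip (sweeps k m) (flips t m k \<omega>)))) \<partial>M)
      = ennreal (coin_mean (flip_prob t m) (length (sweeps k m))
          (\<lambda>cs. exp (l * disc_flux K (zip (sweeps k m) cs))))"
    by (rule trans[OF nn_integral_eq_integral[OF E(2)]]) (simp_all only: E(3), simp)
qed

text \<open>The flux is not shown to be measurable: it is almost surely the eventual value of its measurable
  discrete approximations, and Fatou's lemma bounds the (lower) integral of any such function.\<close>

lemma exp_alternating_flux_le:
  assumes t: "0 < t"
  shows "(\<integral>\<^sup>+\<omega>. ennreal (exp (l * \<bar>alternating_flux N t \<omega>\<bar>)) \<partial>M)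
    \<le> ennreal (2 * exp ((exp l + exp (- l) - 2) * (2 * sqrt (t + 1) + 1) + exp \<bar>l\<bar>))"
proof -
  define C where "C = exp ((exp l + exp (- l) - 2) * (2 * sqrt (t + 1) + 1) + exp \<bar>l\<bar>)"
  \<comment> \<open>Requirements on the number of sweeps once the box is fixed: monotonicity of the
    walk, mean square displacement at most t + 1, and summable probabilities of crowding.\<close>
  define good where "good K m \<longleftrightarrow> m \<noteq> 0 \<and> flip_prob t m \<le> 1 / 2 \<and>
    m * (2 * flip_prob t m + (flip_prob t m)\<^sup>2 * sweep_err (2 * K)) \<le> t + 1 \<and>
    prob (crowded t m (2 * K)) \<le> (1 / 2) ^ K" for K m
  have "\<exists>m. good K m" for K
  proof -
    \<comment> \<open>A sum of nonnegative thresholds, so that any \<open>m\<close> above it exceeds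
      each of them.\<close>
    define R where "R = 1 + t + t\<^sup>2 * sweep_err (2 * K)
      + (real (length (bonds (2 * K))))\<^sup>2 * t\<^sup>2 * 2 ^ K"
    obtain m :: nat where m: "R \<le> m" using real_arch_simple by blast
    have err: "0 \<le> sweep_err (2 * K)" by (simp add: sweep_err_def)
    have parts: "1 \<le> real m" "t \<le> m" "t\<^sup>2 * sweep_err (2 * K) \<le> m"
      "(real (length (bonds (2 * K))))\<^sup>2 * t\<^sup>2 * 2 ^ K \<le> m"
    proof -
      have "0 \<le> t\<^sup>2 * sweep_err (2 * K)" "0 \<le> (real (length (bonds (2 * K))))\<^sup>2 * t\<^sup>2 * 2 ^ K"
        using err by auto
      then show "1 \<le> real m" "t \<le> m" "t\<^sup>2 * sweep_err (2 * K) \<le> m"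
        "(real (length (bonds (2 * K))))\<^sup>2 * t\<^sup>2 * 2 ^ K \<le> m"
        using m t unfolding R_def by linarith+
    qed
    have m0: "m \<noteq> 0" using parts(1) by auto
    note p = flip_prob_bounds[OF t m0]
    have "t / m \<le> 1" using parts m0 by (simp add: divide_le_eq)
    then have "flip_prob t m \<le> 1 / 2"
      using order.trans[OF p(2) divide_right_mono[of "t / m" 1 2]] by simp
    moreover have "m * (2 * flip_prob t m + (flip_prob t m)\<^sup>2 * sweep_err (2 * K)) \<le> t + 1"
    proof -
      have "m * (2 * flip_prob t m + (flip_prob t m)\<^sup>2 * sweep_err (2 * K))
        \<le> m * (2 * (t / m / 2) + (t / m / 2)\<^sup>2 * sweep_err (2 * K))"
        using p err by (intro mult_left_mono add_mono mult_right_mono power_mono) auto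
      also have "\<dots> = t + t\<^sup>2 * sweep_err (2 * K) / m / 4"
        using m0 by (simp add: field_simps power2_eq_square)
      also have "\<dots> \<le> t + 1" using parts m0 by (simp add: field_simps)
      finally show ?thesis .
    qed
    moreover have "prob (crowded t m (2 * K)) \<le> (1 / 2) ^ K"
    proof -
      have "prob (crowded t m (2 * K)) \<le> (real (length (bonds (2 * K))))\<^sup>2 * t\<^sup>2 / m"
        by (rule prob_crowded[OF t m0])
      also have "\<dots> \<le> (1 / 2) ^ K" using parts(4) m0 by (simp add: field_simps power_divide)
      finally show ?thesis .
    qed
    ultimately show ?thesis using m0 unfolding good_def by blast
  qed
  then obtain m where m: "\<And>K. good K (m K)" by metis
  then have m0: "m K \<noteq> 0" for K by (simp add: good_def)
  define W where "W K \<omega> = disc_flux K (zip (sweeps (2 * K) (m K)) (flips t (m K) (2 * K) \<omega>))" for K \<omega>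
  have "summable (\<lambda>K. prob (crowded t (m K) (2 * K)))"
    by (rule summable_comparison_test'[OF summable_geometric[of "1 / 2 :: real"]])
      (use m in \<open>auto simp: good_def\<close>)
  then have ev: "AE \<omega> in M. \<forall>\<^sub>F K in sequentially. alternating_flux N t \<omega> = W K \<omega>"
    unfolding W_def by (intro flux_eq_disc_flux_eventually t m0)
  \<comment> \<open>Removes the absolute value. Both exponential moments obey the same bound, which
    is where the factor 2 comes from.\<close>
  have exp_le: "exp (l * \<bar>w\<bar>) \<le> exp (l * w) + exp (- l * w)" for w :: real
    by (cases "0 \<le> w") auto
  have half: "(\<integral>\<^sup>+\<omega>. ennreal (exp (l' * W K \<omega>)) \<partial>M) \<le> ennreal C" if "\<bar>l'\<bar> = \<bar>l\<bar>" for l' K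
  proof -
    have l': "exp l' + exp (- l') = exp l + exp (- l)" using that by (auto simp: abs_if split: if_splits)
    have "coin_mean (flip_prob t (m K)) (length (sweeps (2 * K) (m K)))
          (\<lambda>cs. exp (l' * disc_flux K (zip (sweeps (2 * K) (m K)) cs)))
      \<le> exp ((exp l' + exp (- l') - 2) * (2 * sqrt (t + 1) + 1) + exp \<bar>l'\<bar>)"
      using m[of K] t flip_prob_bounds[OF t m0] by (intro coin_mean_exp_disc_flux) (auto simp: good_def)
    also have "\<dots> = C" by (simp add: C_def l' that)
    finally show ?thesis
      unfolding W_def expectation_exp_disc_flux(2)[OF t m0] by (rule ennreal_leI)
  qed
  have meas: "(\<lambda>\<omega>. exp (l' * W K \<omega>)) \<in> borel_measurable M" for l' K
    unfolding W_def by (rule expectation_exp_disc_flux(1)[OF t m0])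
  let ?V = "\<lambda>K \<omega>. ennreal (exp (l * W K \<omega>)) + ennreal (exp (- l * W K \<omega>))"
  have V: "(\<integral>\<^sup>+\<omega>. ?V K \<omega> \<partial>M) \<le> ennreal (2 * C)" for K
  proof -
    have "(\<integral>\<^sup>+\<omega>. ?V K \<omega> \<partial>M)
      = (\<integral>\<^sup>+\<omega>. ennreal (exp (l * W K \<omega>)) \<partial>M) + (\<integral>\<^sup>+\<omega>. ennreal (exp (- l * W K \<omega>)) \<partial>M)"
      by (intro nn_integral_add measurable_compose[OF meas measurable_ennreal])
    also have "\<dots> \<le> ennreal C + ennreal C" by (intro add_mono half) auto
    also have "\<dots> = ennreal (2 * C)" by (subst ennreal_plus[symmetric]) (auto simp: C_def)
    finally show ?thesis .
  qed
  have "(\<integral>\<^sup>+\<omega>. ennreal (exp (l * \<bar>alternating_flux N t \<omega>\<bar>)) \<partial>M)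
    \<le> (\<integral>\<^sup>+\<omega>. liminf (\<lambda>K. ?V K \<omega>) \<partial>M)"
  proof (rule nn_integral_mono_AE, use ev in eventually_elim)
    case (elim \<omega>)
    show ?case
    proof (rule Liminf_bounded)
      show "\<forall>\<^sub>F K in sequentially. ennreal (exp (l * \<bar>alternating_flux N t \<omega>\<bar>)) \<le> ?V K \<omega>"
        using elim
      proof eventually_elim
        case (elim K)
        have "ennreal (exp (l * \<bar>W K \<omega>\<bar>)) \<le> ennreal (exp (l * W K \<omega>) + exp (- l * W K \<omega>))"
          by (rule ennreal_leI[OF exp_le])
        also have "\<dots> = ?V K \<omega>" by (rule ennreal_plus) simp_all
        finally show ?case unfolding elim .
      qed
    qed
  qed
  also have "\<dots> \<le> liminf (\<lambda>K. \<integral>\<^sup>+\<omega>. ?V K \<omega> \<partial>M)"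
    by (intro nn_integral_liminf borel_measurable_add measurable_compose[OF meas measurable_ennreal])
  also have "\<dots> \<le> limsup (\<lambda>K. \<integral>\<^sup>+\<omega>. ?V K \<omega> \<partial>M)" by (rule Liminf_le_Limsup) simp
  also have "\<dots> \<le> ennreal (2 * C)" by (rule Limsup_bounded) (use V in simp)
  finally show ?thesis by (simp add: C_def)
qed

section \<open>Diffusive scaling and the tail estimate\<close>

text \<open>For \<open>l\<close> = t^(-1/4) one has l^2 sqrt t = 1, and the exponent is at most e^l
  (3 + 3 l^2): 2 + 3 l^2 from the quadratic term, 1 from the imbalance of the two sums. This
  increases with \<open>l\<close>, and \<open>l0\<close> is the largest \<open>l\<close> on [t0,
  infinity).\<close>

lemma exp_scaled_flux_bounded:
  assumes "0 < t0"
  shows "\<exists>C::real. 0 \<le> C \<and> (\<forall>t\<ge>t0.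
    (\<integral>\<^sup>+\<omega>. ennreal (exp \<bar>alternating_flux N t \<omega> / t powr (1 / 4)\<bar>) \<partial>M) \<le> ennreal C)"
proof -
  define l0 where "l0 = t0 powr (- 1 / 4)"
  define C where "C = 2 * exp (exp l0 * (3 + 3 * l0\<^sup>2))"
  have "(\<integral>\<^sup>+\<omega>. ennreal (exp \<bar>alternating_flux N t \<omega> / t powr (1 / 4)\<bar>) \<partial>M) \<le> ennreal C"
    if "t0 \<le> t" for t
  proof -
    have t: "0 < t" using that assms by simp
    define l where "l = t powr (- 1 / 4)"
    have l: "0 < l" "l \<le> l0"
      using t assms that by (auto simp: l_def l0_def intro!: powr_mono2')
    have sq: "l\<^sup>2 * sqrt t = 1"
    proof -
      have "l\<^sup>2 * sqrt t = t powr (- 1 / 4) * t powr (- 1 / 4) * t powr (1 / 2)"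
        using t by (simp add: l_def power2_eq_square powr_half_sqrt)
      also have "\<dots> = t powr 0" by (simp only: powr_add[symmetric]) simp
      finally show ?thesis using t by simp
    qed
    have "sqrt (t + 1) \<le> sqrt t + 1" using sqrt_add_le_add_sqrt[of t 1] t by simp
    then have "l\<^sup>2 * (2 * sqrt (t + 1) + 1) \<le> l\<^sup>2 * (2 * sqrt t + 3)"
      by (intro mult_left_mono) auto
    also have "\<dots> = 2 + 3 * l\<^sup>2" using sq by (simp add: algebra_simps)
    finally have A: "l\<^sup>2 * (2 * sqrt (t + 1) + 1) \<le> 2 + 3 * l\<^sup>2" .
    have "(exp l + exp (- l) - 2) * (2 * sqrt (t + 1) + 1)
      \<le> l\<^sup>2 * exp \<bar>l\<bar> * (2 * sqrt (t + 1) + 1)"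
      using t by (intro mult_right_mono exp_plus_exp_minus_le) auto
    also have "\<dots> = exp l * (l\<^sup>2 * (2 * sqrt (t + 1) + 1))" using l by simp
    also have "\<dots> \<le> exp l * (2 + 3 * l\<^sup>2)" using A by (intro mult_left_mono) auto
    finally have "(exp l + exp (- l) - 2) * (2 * sqrt (t + 1) + 1) + exp \<bar>l\<bar> \<le> exp l * (3 + 3 * l\<^sup>2)"
      using l by (simp add: algebra_simps)
    also have "\<dots> \<le> exp l0 * (3 + 3 * l0\<^sup>2)"
      using l by (intro mult_mono add_mono power_mono) auto
    finally have B: "2 * exp ((exp l + exp (- l) - 2) * (2 * sqrt (t + 1) + 1) + exp \<bar>l\<bar>) \<le> C"
      by (simp add: C_def)
    have "\<bar>alternating_flux N t \<omega> / t powr (1 / 4)\<bar> = l * \<bar>alternating_flux N t \<omega>\<bar>" for \<omega>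
      using t by (simp add: l_def powr_minus_divide abs_divide)
    then have "(\<integral>\<^sup>+\<omega>. ennreal (exp \<bar>alternating_flux N t \<omega> / t powr (1 / 4)\<bar>) \<partial>M)
      = (\<integral>\<^sup>+\<omega>. ennreal (exp (l * \<bar>alternating_flux N t \<omega>\<bar>)) \<partial>M)" by simp
    also have "\<dots> \<le> ennreal C"
      by (rule order.trans[OF exp_alternating_flux_le[OF t] ennreal_leI[OF B]])
    finally show ?thesis .
  qed
  then show ?thesis by (intro exI[of _ C]) (auto simp: C_def)
qed

text \<open>If the event is not measurable, its \<open>measure\<close> is 0 by convention.\<close>

lemma flux_tail:
  assumes C: "0 \<le> C" "(\<integral>\<^sup>+\<omega>. ennreal (exp \<bar>alternating_flux N t \<omega> / t powr (1 / 4)\<bar>) \<partial>M) \<le> ennreal C"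
    and t: "1 \<le> t"
  shows "prob {\<omega>\<in>space M. \<bar>alternating_flux N t \<omega>\<bar> > K * t powr (1 / 4) * ln t} \<le> C * t powr (- K)"
proof -
  define A where "A = {\<omega>\<in>space M. \<bar>alternating_flux N t \<omega>\<bar> > K * t powr (1 / 4) * ln t}"
  have "prob A \<le> C * t powr (- K)"
  proof (cases "A \<in> events")
    case True
    \<comment> \<open>Markov's inequality in integrated form: on \<open>A\<close> the exponent
      exceeds K ln t, and exp (K ln t) is \<open>t powr K\<close>.\<close>
    have "ennreal (t powr K) * indicator A \<omega> \<le> ennreal (exp \<bar>alternating_flux N t \<omega> / t powr (1 / 4)\<bar>)" for \<omega>
    proof (cases "\<omega> \<in> A")
      case True
      then have "K * ln t \<le> \<bar>alternating_flux N t \<omega> / t powr (1 / 4)\<bar>"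
        using t by (simp add: A_def abs_divide field_simps)
      then show ?thesis using True t by (auto intro!: ennreal_leI simp: powr_def)
    qed simp
    then have "(\<integral>\<^sup>+\<omega>. ennreal (t powr K) * indicator A \<omega> \<partial>M) \<le> ennreal C"
      by (intro order.trans[OF nn_integral_mono C(2)])
    then have "ennreal (t powr K * prob A) \<le> ennreal C"
      by (simp add: nn_integral_cmult_indicator[OF True] emeasure_eq_measure ennreal_mult)
    then have "t powr K * prob A \<le> C" using C by simp
    then have le: "t powr (- K) * (t powr K * prob A) \<le> t powr (- K) * C" by (rule mult_left_mono) simp
    have "t powr (- K) * t powr K = 1" using t by (simp flip: powr_add)
    then have "prob A = t powr (- K) * (t powr K * prob A)" by (simp only: mult.assoc[symmetric] mult_1_left)
    also note le
    finally show ?thesis by (simp only: mult.commute)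
  next
    case False
    then show ?thesis using C by (simp add: measure_notin_sets)
  qed
  then show ?thesis by (simp add: A_def)
qed

end

text \<open>The supremum runs over times bounded away from 0: for small t a single exchange across
  {-1, 0} has probability of order t and makes the flux -1, so the expectation is at least of order
  t exp (t^(-1/4)), which is unbounded as t tends to 0. The tail estimate takes its constant from
  \<open>t0\<close> = 1, so \<open>c\<close> does not depend on \<open>K\<close>.\<close>

theorem lemma49:
  fixes M :: "'w measure" and N :: "int \<Rightarrow> real \<Rightarrow> 'w \<Rightarrow> nat"
  assumes "prob_space M"
    and "independent_poisson_processes M (1 / 2) N"
  shows "(\<forall>t\<^sub>0>0. (SUP t\<in>{t\<^sub>0..}. \<integral>\<^sup>+\<omega>. ennreal (exp \<bar>alternating_flux N t \<omega> / t powr (1 / 4)\<bar>) \<partial>M) < \<infinity>) \<and>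
    (\<exists>c::real. \<forall>K>0. \<forall>\<^sub>F t in at_top.
       measure M {\<omega>\<in>space M. \<bar>alternating_flux N t \<omega>\<bar> > K * t powr (1 / 4) * ln t} \<le> c * t powr (- K))"
proof -
  interpret poisson_clocks M N
    using assms by (simp add: poisson_clocks_def poisson_clocks_axioms_def)
  show ?thesis
  proof (intro conjI allI impI)
    fix t0 :: real assume "0 < t0"
    then obtain C where "\<forall>t\<ge>t0.
        (\<integral>\<^sup>+\<omega>. ennreal (exp \<bar>alternating_flux N t \<omega> / t powr (1 / 4)\<bar>) \<partial>M) \<le> ennreal C"
      using exp_scaled_flux_bounded by blast
    then have "(SUP t\<in>{t0..}. \<integral>\<^sup>+\<omega>. ennreal (exp \<bar>alternating_flux N t \<omega> / t powr (1 / 4)\<bar>) \<partial>M) \<le> ennreal C"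
      by (intro SUP_least) auto
    then show "(SUP t\<in>{t0..}. \<integral>\<^sup>+\<omega>. ennreal (exp \<bar>alternating_flux N t \<omega> / t powr (1 / 4)\<bar>) \<partial>M) < \<infinity>"
      using ennreal_less_top[of C] by (simp add: order.strict_trans1)
  next
    obtain C where C: "0 \<le> C" "\<forall>t\<ge>1.
        (\<integral>\<^sup>+\<omega>. ennreal (exp \<bar>alternating_flux N t \<omega> / t powr (1 / 4)\<bar>) \<partial>M) \<le> ennreal C"
      using exp_scaled_flux_bounded[of 1] by auto
    have "\<forall>\<^sub>F t in at_top. measure M {\<omega>\<in>space M. \<bar>alternating_flux N t \<omega>\<bar> > K * t powr (1 / 4) * ln t}
        \<le> C * t powr (- K)" for K
      using eventually_ge_at_top[of "1::real"] by eventually_elim (rule flux_tail, use C in auto)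
    then show "\<exists>c::real. \<forall>K>0. \<forall>\<^sub>F t in at_top.
       measure M {\<omega>\<in>space M. \<bar>alternating_flux N t \<omega>\<bar> > K * t powr (1 / 4) * ln t} \<le> c * t powr (- K)"
      by blast
  qed
qed

end
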